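(* Let $s$ and $t$ be integers with $2\leq s\leq t-1$, and let $p\in(0,1)$. Then $$\gamma^{\frac{s}{t}}(G(n,p))\in \left[\lfloor a_{p}(n)\rfloor_{t}+\frac{1}{t},\ b_{p,t}(n)\right]\setminus\left\{b_{p,t}(n)-\frac{i}{t}: t-s+1\leq i\leq t-1\right\}$$ with probability tending to $1$ as $n\to\infty$.
   Context: For a graph $G$ and $u\in V(G)$, $N_G(u)$ is the set of neighbours of $u$. For $c\in\mathbb{R}^{+}\cup\{\infty\}$, a function $f:V(G)\to\mathbb{R}^{+}\cup\{0,\infty\}$ is a $c$-self dominating function ($c$-SDF) of $G$ if for every $u\in V(G)$, $f(u)\geq c$ or $\max\{f(v):v\in N_G(u)\}\geq 1$. The weight is $w(f)=\sum_{u\in V(G)}f(u)$, and the $c$-self domination number $\gamma^{c}(G)$ is the minimum weight of a $c$-SDF of $G$ (it is attained by a function with values in $\{0,1,c\}$). $G(n,p)$ is the Erdős–Rényi random graph on vertex set $\{1,\dots,n\}$ with each edge present independently with probability $p$. For $p\in(0,1)$ and integers $n\geq 2$, $a_{p}(n)=\log_{1/(1-p)}\frac{n}{\log_{1/(1-p)}n\cdot\ln n}$. For $t\in\mathbb{Z}^{+}$ and $a\in\mathbb{R}$, $\lfloor a\rfloor_{t}$ is the largest number in $\{m_1+\frac{m_2}{t}: m_1,m_2\in\mathbb{Z},\ m_1+\frac{m_2}{t}\leq a\}$. Finally $b_{p,t}(n)=\left\lfloor \lfloor a_{p}(n)\rfloor_{t}+\frac{1}{t}\right\rfloor+1$. 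*)

theory Defs
  imports "HOL-Probability.Probability"
begin

text \<open>
  A finite simple graph is given by its vertex set \<open>V\<close> and its edge set \<open>E\<close>, a set of
  two-element subsets of \<open>V\<close>.
\<close>

definition nbhd :: "'a set \<Rightarrow> 'a set set \<Rightarrow> 'a \<Rightarrow> 'a set" where
  "nbhd V E u = {v \<in> V. {u, v} \<in> E}"

text \<open>
  The type \<^typ>\<open>ennreal\<close> consists of the nonnegative reals and \<open>\<infinity>\<close>. Neighbourhoods are
  finite, so the supremum below is the maximum; for an isolated vertex it is \<open>0\<close>, so that
  such a vertex must satisfy \<open>f u \<ge> c\<close>. Only the values of \<open>f\<close> on \<open>V\<close> matter.
\<close>

definition self_dominating :: "ennreal \<Rightarrow> 'a set \<Rightarrow> 'a set set \<Rightarrow> ('a \<Rightarrow> ennreal) \<Rightarrow> bool" where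
  "self_dominating c V E f \<longleftrightarrow>
     (\<forall>u\<in>V. f u \<ge> c \<or> (SUP v\<in>nbhd V E u. f v) \<ge> 1)"

definition weight :: "'a set \<Rightarrow> ('a \<Rightarrow> ennreal) \<Rightarrow> ennreal" where
  "weight V f = (\<Sum>u\<in>V. f u)"

definition self_dom_number :: "ennreal \<Rightarrow> 'a set \<Rightarrow> 'a set set \<Rightarrow> ennreal" where
  "self_dom_number c V E =
     (LEAST w. w \<in> {weight V f | f. self_dominating c V E f})"

text \<open>The minimum exists, and it is attained by a function with values in \<open>{0, 1, c}\<close>.\<close>

lemma self_dom_number_attained:
  fixes c :: ennreal
  assumes fin: "finite V"
  obtains f where "self_dominating c V E f" "\<And>u. u \<in> V \<Longrightarrow> f u \<in> {0, 1, c}"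
    and "weight V f = self_dom_number c V E"
    and "\<And>g. self_dominating c V E g \<Longrightarrow> weight V f \<le> weight V g"
proof -
  define F where "F = {f \<in> V \<rightarrow>\<^sub>E {0, 1, c}. self_dominating c V E f}"
  have "finite (V \<rightarrow>\<^sub>E {0, 1, c})"
    using fin by (intro finite_PiE) auto
  hence finF: "finite F"
    unfolding F_def by simp
  have nbhd_sub: "nbhd V E u \<subseteq> V" for u
    by (auto simp: nbhd_def)
  have reduce: "\<exists>f\<in>F. weight V f \<le> weight V g" if g: "self_dominating c V E g" for g
  proof -
    define r where "r x = Max {y \<in> {0, 1, c}. y \<le> x}" for x
    have r_in: "r x \<in> {y \<in> {0, 1, c}. y \<le> x}" for x
      unfolding r_def by (rule Max_in) auto
    have r_ge: "y \<le> r x" if "y \<in> {0, 1, c}" "y \<le> x" for x y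
      unfolding r_def using that by (intro Max_ge) auto
    define f where "f = restrict (r \<circ> g) V"
    have "f u \<ge> c \<or> (SUP v\<in>nbhd V E u. f v) \<ge> 1" if u: "u \<in> V" for u
    proof (cases "g u \<ge> c")
      case True
      thus ?thesis using u r_ge[of c "g u"] by (simp add: f_def)
    next
      case False
      hence sup: "(SUP v\<in>nbhd V E u. g v) \<ge> 1"
        using g u by (auto simp: self_dominating_def)
      hence ne: "nbhd V E u \<noteq> {}"
        by (auto simp: bot_ennreal)
      have "finite (nbhd V E u)"
        using nbhd_sub fin by (rule finite_subset)
      hence "(SUP v\<in>nbhd V E u. g v) \<in> g ` nbhd V E u"
        using ne by (simp add: Max_Sup[symmetric] Max_in)
      then obtain v where v: "v \<in> nbhd V E u" "g v \<ge> 1"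
        using sup by auto
      hence "f v \<ge> 1"
        using r_ge[of 1 "g v"] nbhd_sub[of u] by (auto simp: f_def)
      thus ?thesis
        using v(1) by (meson SUP_upper2)
    qed
    hence "self_dominating c V E f"
      by (auto simp: self_dominating_def)
    moreover have "f \<in> V \<rightarrow>\<^sub>E {0, 1, c}"
      unfolding f_def using r_in by (auto simp: PiE_iff)
    moreover have "weight V f \<le> weight V g"
      unfolding weight_def f_def using r_in by (intro sum_mono) auto
    ultimately show ?thesis
      unfolding F_def by blast
  qed
  have "self_dominating c V E (\<lambda>_. c)"
    by (simp add: self_dominating_def)
  hence neF: "F \<noteq> {}"
    using reduce by blast
  obtain f where f: "f \<in> F" "\<And>h. h \<in> F \<Longrightarrow> weight V f \<le> weight V h"
    using ex_min_if_finite[of "weight V ` F"] finF neF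
    by (metis (no_types, lifting) finite_imageI image_is_empty image_iff not_less)
  have min: "weight V f \<le> weight V g" if "self_dominating c V E g" for g
    using reduce[OF that] f(2) order_trans by blast
  have sd: "self_dominating c V E f"
    using f(1) by (simp add: F_def)
  have "self_dom_number c V E = weight V f"
    unfolding self_dom_number_def using sd min by (intro Least_equality) auto
  thus ?thesis
    using that[of f] sd min f(1) by (auto simp: F_def PiE_iff)
qed

definition gnp :: "nat \<Rightarrow> real \<Rightarrow> nat set set pmf" where
  "gnp n p =
     (let P = {e. e \<subseteq> {1..n} \<and> card e = 2}
      in map_pmf (\<lambda>x. {e \<in> P. x e}) (Pi_pmf P False (\<lambda>_. bernoulli_pmf p)))"

definition a_fun :: "real \<Rightarrow> nat \<Rightarrow> real" where
  "a_fun p n =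
     log (1 / (1 - p)) (real n / (log (1 / (1 - p)) (real n) * ln (real n)))"

definition floor_frac :: "int \<Rightarrow> real \<Rightarrow> real" where
  "floor_frac t a =
     (GREATEST x. x \<in> {real_of_int m1 + of_int m2 / of_int t | m1 m2 :: int.
                        real_of_int m1 + of_int m2 / of_int t \<le> a})"

lemma floor_frac_eq:
  assumes "t > 0"
  shows "floor_frac t a = of_int \<lfloor>of_int t * a\<rfloor> / of_int t"
  unfolding floor_frac_def
proof (rule Greatest_equality)
  have "real_of_int \<lfloor>of_int t * a\<rfloor> / of_int t \<le> a"
    using assms by (simp add: divide_le_eq mult.commute)
  thus "of_int \<lfloor>of_int t * a\<rfloor> / of_int t \<in>
      {real_of_int m1 + of_int m2 / of_int t | m1 m2 :: int.
         real_of_int m1 + of_int m2 / of_int t \<le> a}"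
    by (intro CollectI exI[of _ "0::int"] exI[of _ "\<lfloor>of_int t * a\<rfloor>"]) simp
next
  fix y
  assume "y \<in> {real_of_int m1 + of_int m2 / of_int t | m1 m2 :: int.
                 real_of_int m1 + of_int m2 / of_int t \<le> a}"
  then obtain m1 m2 :: int where y: "y = real_of_int m1 + of_int m2 / of_int t" "y \<le> a"
    by auto
  have eq: "y * of_int t = of_int (m1 * t + m2)"
    using assms y(1) by (simp add: field_simps)
  have "y * of_int t \<le> of_int t * a"
    using y(2) assms by (simp add: mult.commute)
  hence "of_int (m1 * t + m2) \<le> of_int t * a"
    by (simp only: eq)
  hence "m1 * t + m2 \<le> \<lfloor>of_int t * a\<rfloor>"
    by (simp only: le_floor_iff)
  hence "y * of_int t \<le> of_int \<lfloor>of_int t * a\<rfloor>"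
    by (simp only: eq of_int_le_iff)
  thus "y \<le> of_int \<lfloor>of_int t * a\<rfloor> / of_int t"
    using assms by (simp add: le_divide_eq)
qed

definition b_fun :: "real \<Rightarrow> int \<Rightarrow> nat \<Rightarrow> int" where
  "b_fun p t n = \<lfloor>floor_frac t (a_fun p n) + 1 / of_int t\<rfloor> + 1"

end

theory Submission
  imports Defs "HOL-Real_Asymp.Real_Asymp"
begin

text \<open>
  A minimal \<open>s/t\<close>-self dominating function has values in \<open>{0, 1, s/t}\<close>; with \<open>D = {f = 1}\<close> its weight
  is \<open>|D| + (s/t) m\<close>, where \<open>m\<close> is at least the number of vertices outside \<open>D\<close> without a neighbour
  in \<open>D\<close>.

  By the first moment method, for every constant \<open>K\<close>, with high probability each \<open>D\<close> with \<open>|D| \<le> a\<close>,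
  \<open>a = a\<^sub>p(n)\<close>, leaves more than \<open>K (a - |D|)\<close> vertices undominated: decreasing \<open>|D|\<close> by \<open>d\<close> multiplies
  the expected number of such vertices by \<open>(1 - p)\<close> to the power \<open>-d\<close>, which outweighs the choice of
  \<open>O(d)\<close> exceptional vertices. Hence the weight exceeds \<open>a\<close>. It also avoids the gap
  \<open>(b - 1, b - 1 + s/t)\<close>, \<open>b = b\<^sub>p\<^sub>,\<^sub>t(n)\<close>, since a non-integer weight in it has \<open>m \<ge> 1\<close>, so
  \<open>|D| \<le> b - 2 \<le> a + 1/t - 1\<close>, and then \<open>a - |D|\<close> is bounded away from \<open>0\<close> while \<open>m\<close> is only
  \<open>O(a - |D|)\<close>.

  By the second moment method there is a dominating set of size \<open>b\<close>, because \<open>b \<ge> a + 1/t\<close> leaves a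
  constant margin in the exponent.
\<close>

section \<open>Neighbourhoods in the random graph\<close>

lemma prob_pair_pmf_Times:
  "measure_pmf.prob (pair_pmf M N) (A \<times> B) = measure_pmf.prob M A * measure_pmf.prob N B"
proof -
  have "emeasure (pair_pmf M N) (A \<times> B) = (\<integral>\<^sup>+z. indicator (A \<times> B) z \<partial>pair_pmf M N)"
    by simp
  also have "\<dots> = (\<integral>\<^sup>+x. \<integral>\<^sup>+y. indicator A x * indicator B y \<partial>N \<partial>M)"
    by (simp add: nn_integral_pair_pmf' indicator_times)
  also have "\<dots> = emeasure M A * emeasure N B"
    by (simp add: nn_integral_cmult nn_integral_multc)
  finally show ?thesis
    by (simp add: measure_pmf.emeasure_eq_measure flip: ennreal_mult)
qed

definition pairs :: "nat \<Rightarrow> nat set set" where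
  "pairs n = {e. e \<subseteq> {1..n} \<and> card e = 2}"

lemma finite_pairs [simp]: "finite (pairs n)"
  by (rule finite_subset[of _ "Pow {1..n}"]) (auto simp: pairs_def)

lemma gnp_altdef:
  "gnp n p = map_pmf (\<lambda>x. {e \<in> pairs n. x e}) (Pi_pmf (pairs n) False (\<lambda>_. bernoulli_pmf p))"
  by (simp add: gnp_def pairs_def)

text \<open>The hypotheses encode that \<open>A\<close> looks only at edges in \<open>F\<close> and
  \<open>B\<close> only at edges outside \<open>F\<close>. Splitting the product measure along
  \<open>F\<close> turns the joint event into a rectangle.\<close>

lemma gnp_indep:
  assumes A: "\<And>E. A E \<longleftrightarrow> A (E \<inter> F)" and B: "\<And>E. B E \<longleftrightarrow> B (E - F)"
  shows "measure_pmf.prob (gnp n p) {E. A E \<and> B E} =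
    measure_pmf.prob (gnp n p) {E. A E} * measure_pmf.prob (gnp n p) {E. B E}"
proof -
  define P1 P2 where "P1 = pairs n \<inter> F" and "P2 = pairs n - F"
  define X Y where "X = Pi_pmf P1 False (\<lambda>_. bernoulli_pmf p)"
    and "Y = Pi_pmf P2 False (\<lambda>_. bernoulli_pmf p)"
  define h :: "(nat set \<Rightarrow> bool) \<times> (nat set \<Rightarrow> bool) \<Rightarrow> nat set set"
    where "h = (\<lambda>(f, g). {e \<in> pairs n. if e \<in> P1 then f e else g e})"
  have P: "pairs n = P1 \<union> P2"
    by (auto simp: P1_def P2_def)
  have "gnp n p = map_pmf (\<lambda>x. {e \<in> pairs n. x e}) (Pi_pmf (P1 \<union> P2) False (\<lambda>_. bernoulli_pmf p))"
    by (simp add: gnp_altdef flip: P)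
  also have "\<dots> = map_pmf (\<lambda>x. {e \<in> pairs n. x e})
      (map_pmf (\<lambda>(f,g) x. if x \<in> P1 then f x else g x) (pair_pmf X Y))"
    unfolding X_def Y_def by (subst Pi_pmf_union) (auto simp: P1_def P2_def)
  also have "\<dots> = map_pmf h (pair_pmf X Y)"
    by (simp add: map_pmf_comp h_def case_prod_unfold)
  finally have gnp: "gnp n p = map_pmf h (pair_pmf X Y)" .
  have a: "A (h (f, g)) \<longleftrightarrow> A {e \<in> P1. f e}" for f g
    by (subst A) (auto simp: h_def P1_def intro!: arg_cong[where f = A])
  have b: "B (h (f, g)) \<longleftrightarrow> B {e \<in> P2. g e}" for f g
    by (subst B) (auto simp: h_def P1_def P2_def intro!: arg_cong[where f = B])
  have "{z. A (h z) \<and> B (h z)} = {f. A {e \<in> P1. f e}} \<times> {g. B {e \<in> P2. g e}}"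
    "{z. A (h z)} = {f. A {e \<in> P1. f e}} \<times> UNIV"
    "{z. B (h z)} = UNIV \<times> {g. B {e \<in> P2. g e}}"
    by (auto simp: a b)
  then show ?thesis
    by (simp add: gnp vimage_def prob_pair_pmf_Times)
qed

lemma prob_gnp_no_edges:
  assumes "F \<subseteq> pairs n" "0 \<le> p" "p \<le> 1"
  shows "measure_pmf.prob (gnp n p) {E. E \<inter> F = {}} = (1 - p) ^ card F"
proof -
  define B :: "nat set \<Rightarrow> bool set" where "B e = (if e \<in> F then {False} else UNIV)" for e
  have "(\<lambda>x. {e \<in> pairs n. x e}) -` {E. E \<inter> F = {}} = Pi (pairs n) B"
    using assms(1) by (auto simp: B_def Pi_iff split: if_splits)
  then have "measure_pmf.prob (gnp n p) {E. E \<inter> F = {}} =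
      (\<Prod>e\<in>pairs n. measure_pmf.prob (bernoulli_pmf p) (B e))"
    by (simp add: gnp_altdef measure_Pi_pmf_Pi)
  also have "\<dots> = (\<Prod>e\<in>pairs n. if e \<in> F then 1 - p else 1)"
    using assms by (intro prod.cong) (auto simp: B_def measure_pmf_single)
  also have "\<dots> = (1 - p) ^ card F"
    using assms(1) by (simp add: prod.If_cases Int_absorb1)
  finally show ?thesis .
qed

lemma prob_gnp_not_adjacent:
  assumes "T \<subseteq> {1..n}" "v \<in> {1..n}" "v \<notin> T" "0 \<le> p" "p \<le> 1"
  shows "measure_pmf.prob (gnp n p) {E. \<forall>d\<in>T. {v, d} \<notin> E} = (1 - p) ^ card T"
proof -
  have "card ((\<lambda>d. {v, d}) ` T) = card T"
    using assms(3) by (intro card_image) (auto simp: inj_on_def doubleton_eq_iff)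
  moreover have "(\<lambda>d. {v, d}) ` T \<subseteq> pairs n"
    using assms by (auto simp: pairs_def card_2_iff)
  moreover have "{E. \<forall>d\<in>T. {v, d} \<notin> E} = {E. E \<inter> (\<lambda>d. {v, d}) ` T = {}}"
    by auto
  ultimately show ?thesis
    using prob_gnp_no_edges[of "(\<lambda>d. {v, d}) ` T" n p] assms(4,5) by simp
qed

text \<open>Stars from different vertices of \<open>W\<close> into \<open>T\<close> share no edge
  because \<open>W\<close> and \<open>T\<close> are disjoint. The constraints are thus independent,
  and one vertex at a time can be split off.\<close>

lemma prob_gnp_stars:
  assumes "finite W" "W \<inter> T = {}"
  shows "measure_pmf.prob (gnp n p) {E. \<forall>v\<in>W. Q {d \<in> T. {v, d} \<in> E}} =
    (\<Prod>v\<in>W. measure_pmf.prob (gnp n p) {E. Q {d \<in> T. {v, d} \<in> E}})"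
  using assms
proof (induction W)
  case empty
  then show ?case by simp
next
  case (insert w W)
  define F where "F = (\<lambda>d. {w, d}) ` T"
  have "{d \<in> T. {v, d} \<in> E} = {d \<in> T. {v, d} \<in> E - F}" if "v \<in> W" for v E
    using insert.hyps insert.prems that by (auto simp: F_def doubleton_eq_iff)
  moreover have "{d \<in> T. {w, d} \<in> E} = {d \<in> T. {w, d} \<in> E \<inter> F}" for E
    by (auto simp: F_def)
  ultimately have "measure_pmf.prob (gnp n p)
      {E. Q {d \<in> T. {w, d} \<in> E} \<and> (\<forall>v\<in>W. Q {d \<in> T. {v, d} \<in> E})} =
    measure_pmf.prob (gnp n p) {E. Q {d \<in> T. {w, d} \<in> E}} *
    measure_pmf.prob (gnp n p) {E. \<forall>v\<in>W. Q {d \<in> T. {v, d} \<in> E}}"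
    by (intro gnp_indep[where F = F]) (simp_all cong: ball_cong)
  then show ?case
    using insert by simp
qed

section \<open>The vertices that a fixed set leaves undominated\<close>

definition undominated :: "nat \<Rightarrow> nat set set \<Rightarrow> nat set \<Rightarrow> nat set" where
  "undominated n E D = {v \<in> {1..n} - D. \<forall>d\<in>D. {v, d} \<notin> E}"

text \<open>Inclusion in a prescribed \<open>S\<close> only demands that each vertex outside
  \<open>D \<union> S\<close> have a neighbour in \<open>D\<close>. These demands are independent,
  and each fails with probability \<open>(1 - p) ^ card D\<close>.\<close>

lemma prob_gnp_undominated_subset:
  assumes "D \<subseteq> {1..n}" "S \<subseteq> {1..n}" "S \<inter> D = {}" "0 \<le> p" "p \<le> 1"
  shows "measure_pmf.prob (gnp n p) {E. undominated n E D \<subseteq> S} =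
    (1 - (1 - p) ^ card D) ^ (n - card D - card S)"
proof -
  define W where "W = {1..n} - D - S"
  have fin: "finite D" "finite S"
    using assms finite_subset by blast+
  have card: "card W = n - card D - card S"
  proof -
    have "W = {1..n} - (D \<union> S)" "D \<union> S \<subseteq> {1..n}" "D \<inter> S = {}"
      using assms by (auto simp: W_def)
    then show ?thesis
      using fin by (simp add: card_Diff_subset card_Un_disjoint)
  qed
  have W: "finite W" "W \<inter> D = {}"
    by (auto simp: W_def)
  have "measure_pmf.prob (gnp n p) {E. {d \<in> D. {v, d} \<in> E} \<noteq> {}} = 1 - (1 - p) ^ card D"
    if "v \<in> W" for v
  proof -
    have "{E. {d \<in> D. {v, d} \<in> E} \<noteq> {}} = UNIV - {E. \<forall>d\<in>D. {v, d} \<notin> E}"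
      by auto
    then show ?thesis
      using assms that prob_gnp_not_adjacent[of D n v p] measure_pmf.prob_compl[of _ "gnp n p"]
      by (simp add: W_def)
  qed
  moreover have "{E. undominated n E D \<subseteq> S} = {E. \<forall>v\<in>W. {d \<in> D. {v, d} \<in> E} \<noteq> {}}"
    by (auto simp: W_def undominated_def)
  ultimately show ?thesis
    using prob_gnp_stars[OF W, of n p "\<lambda>X. X \<noteq> {}"] card by simp
qed

text \<open>Inclusion-exclusion at a vertex outside \<open>D1 \<union> D2\<close>: it misses each
  single set with probability \<open>(1 - p) ^ r\<close>, and both with probability
  \<open>(1 - p) ^ (2 * r - i)\<close>, as the union has \<open>2 * r - i\<close> elements.\<close>

lemma prob_gnp_two_dominating_le:
  assumes D: "D1 \<subseteq> {1..n}" "card D1 = r" "D2 \<subseteq> {1..n}" "card D2 = r"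
    and i: "card (D1 \<inter> D2) = i" and p: "0 \<le> p" "p \<le> 1"
  shows "measure_pmf.prob (gnp n p) {E. undominated n E D1 = {} \<and> undominated n E D2 = {}} \<le>
    (1 - 2 * (1 - p) ^ r + (1 - p) ^ (2 * r - i)) ^ (n - (2 * r - i))"
proof -
  define T where "T = D1 \<union> D2"
  define W where "W = {1..n} - T"
  define Q where "Q X \<longleftrightarrow> X \<inter> D1 \<noteq> {} \<and> X \<inter> D2 \<noteq> {}" for X :: "nat set"
  have fin: "finite D1" "finite D2"
    using D finite_subset by blast+
  have cardT: "card T = 2 * r - i"
    using card_Un_Int[OF fin] D i by (simp add: T_def)
  have cardW: "card W = n - (2 * r - i)"
    unfolding W_def using D fin by (subst card_Diff_subset) (auto simp: cardT, auto simp: T_def)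
  have W: "finite W" "W \<inter> T = {}"
    by (auto simp: W_def)
  have "measure_pmf.prob (gnp n p) {E. Q {d \<in> T. {v, d} \<in> E}} =
      1 - 2 * (1 - p) ^ r + (1 - p) ^ (2 * r - i)" if v: "v \<in> W" for v
  proof -
    define A where "A D = {E. \<forall>d\<in>D. {v, d} \<notin> E}" for D
    have pA: "measure_pmf.prob (gnp n p) (A D) = (1 - p) ^ card D" if "D \<subseteq> T" for D
      unfolding A_def using D v that by (intro prob_gnp_not_adjacent p) (auto simp: W_def T_def)
    have "A D1 \<inter> A D2 = A T"
      by (auto simp: A_def T_def)
    then have "measure_pmf.prob (gnp n p) (A D1 \<union> A D2) = 2 * (1 - p) ^ r - (1 - p) ^ (2 * r - i)"
      using pA[of D1] pA[of D2] pA[of T] D cardT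
        measure_pmf.finite_measure_Union'[of "A D1" "gnp n p" "A D2"]
        measure_pmf.finite_measure_Diff'[of "A D2" "gnp n p" "A D1"]
      by (simp add: T_def Int_commute)
    moreover have "{E. Q {d \<in> T. {v, d} \<in> E}} = UNIV - (A D1 \<union> A D2)"
      by (auto simp: Q_def A_def T_def)
    ultimately show ?thesis
      using measure_pmf.prob_compl[of "A D1 \<union> A D2" "gnp n p"] by simp
  qed
  then have "measure_pmf.prob (gnp n p) {E. \<forall>v\<in>W. Q {d \<in> T. {v, d} \<in> E}} =
      (1 - 2 * (1 - p) ^ r + (1 - p) ^ (2 * r - i)) ^ (n - (2 * r - i))"
    using prob_gnp_stars[OF W, of n p Q] cardW by simp
  \<comment> \<open>The vertices of \<open>D1 - D2\<close> and \<open>D2 - D1\<close> are too few to matter; their constraints are dropped.\<close>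
  moreover have "measure_pmf.prob (gnp n p) {E. undominated n E D1 = {} \<and> undominated n E D2 = {}} \<le>
      measure_pmf.prob (gnp n p) {E. \<forall>v\<in>W. Q {d \<in> T. {v, d} \<in> E}}"
    by (intro measure_pmf.finite_measure_mono) (auto simp: undominated_def W_def Q_def T_def)
  ultimately show ?thesis
    by simp
qed

section \<open>Moment bounds\<close>

text \<open>Union bound over \<open>D\<close> and the set \<open>S\<close> that it leaves
  undominated. There are at most \<open>n ^ (k + j)\<close> such pairs of sizes \<open>k\<close> and
  \<open>j\<close>, and for each the event is relaxed to
  \<open>undominated n E D \<subseteq> S\<close>.\<close>

lemma prob_gnp_few_undominated_le:
  assumes "finite I" "0 \<le> p" "p \<le> 1"
  shows "measure_pmf.prob (gnp n p)
      {E. \<exists>D\<subseteq>{1..n}. (card D, card (undominated n E D)) \<in> I} \<le>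
    (\<Sum>(k, j)\<in>I. real n ^ (k + j) * (1 - (1 - p) ^ k) ^ (n - k - j))"
proof -
  define P where "P = (\<lambda>(k, j). {(D, S). D \<subseteq> {1..n} \<and> S \<subseteq> {1..n} \<and> S \<inter> D = {} \<and>
    card D = k \<and> card S = j})"
  define A where "A = (\<lambda>(D, S). {E. undominated n E D \<subseteq> S})"
  have finP: "finite (P x)" for x
    by (rule finite_subset[of _ "Pow {1..n} \<times> Pow {1..n}"]) (auto simp: P_def split: prod.splits)
  have cardP: "real (card (P (k, j))) \<le> real n ^ (k + j)" for k j
  proof -
    have pow: "n choose l \<le> n ^ l" for l
      by (cases "l \<le> n") (simp_all add: binomial_le_pow binomial_eq_0)
    have "card (P (k, j)) \<le> card ({D. D \<subseteq> {1..n} \<and> card D = k} \<times> {S. S \<subseteq> {1..n} \<and> card S = j})"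
      by (intro card_mono) (auto simp: P_def)
    also have "\<dots> = (n choose k) * (n choose j)"
      by (simp add: card_cartesian_product n_subsets)
    also have "\<dots> \<le> n ^ (k + j)"
      unfolding power_add by (intro mult_mono pow) auto
    finally show ?thesis
      by (metis of_nat_le_iff of_nat_power)
  qed
  have "{E. \<exists>D\<subseteq>{1..n}. (card D, card (undominated n E D)) \<in> I} \<subseteq> (\<Union>x\<in>I. \<Union>y\<in>P x. A y)"
  proof
    fix E assume "E \<in> {E. \<exists>D\<subseteq>{1..n}. (card D, card (undominated n E D)) \<in> I}"
    then obtain D where D: "D \<subseteq> {1..n}" "(card D, card (undominated n E D)) \<in> I"
      by blast
    moreover have "(D, undominated n E D) \<in> P (card D, card (undominated n E D))"
      using D(1) by (auto simp: P_def undominated_def)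
    moreover have "E \<in> A (D, undominated n E D)"
      by (simp add: A_def)
    ultimately show "E \<in> (\<Union>x\<in>I. \<Union>y\<in>P x. A y)"
      by blast
  qed
  then have "measure_pmf.prob (gnp n p) {E. \<exists>D\<subseteq>{1..n}. (card D, card (undominated n E D)) \<in> I} \<le>
      measure_pmf.prob (gnp n p) (\<Union>x\<in>I. \<Union>y\<in>P x. A y)"
    by (intro measure_pmf.finite_measure_mono) auto
  also have "\<dots> \<le> (\<Sum>x\<in>I. measure_pmf.prob (gnp n p) (\<Union>y\<in>P x. A y))"
    using assms(1) by (intro measure_pmf.finite_measure_subadditive_finite) auto
  also have "\<dots> \<le> (\<Sum>x\<in>I. \<Sum>y\<in>P x. measure_pmf.prob (gnp n p) (A y))"
    using finP by (intro sum_mono measure_pmf.finite_measure_subadditive_finite) auto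
  also have "\<dots> \<le> (\<Sum>(k, j)\<in>I. real n ^ (k + j) * (1 - (1 - p) ^ k) ^ (n - k - j))"
  proof (intro sum_mono)
    fix x assume "x \<in> I"
    obtain k j where x: "x = (k, j)"
      by force
    have "measure_pmf.prob (gnp n p) (A y) = (1 - (1 - p) ^ k) ^ (n - k - j)" if "y \<in> P x" for y
      using prob_gnp_undominated_subset[of "fst y" n "snd y" p] that assms
      by (auto simp: P_def A_def x)
    then have "(\<Sum>y\<in>P x. measure_pmf.prob (gnp n p) (A y)) =
        real (card (P x)) * (1 - (1 - p) ^ k) ^ (n - k - j)"
      by simp
    also have "\<dots> \<le> real n ^ (k + j) * (1 - (1 - p) ^ k) ^ (n - k - j)"
      using assms(2,3) cardP[of k j] unfolding x
      by (intro mult_right_mono zero_le_power) (simp_all add: power_le_one)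
    finally show "(\<Sum>y\<in>P x. measure_pmf.prob (gnp n p) (A y)) \<le>
        (case x of (k, j) \<Rightarrow> real n ^ (k + j) * (1 - (1 - p) ^ k) ^ (n - k - j))"
      by (simp add: x)
  qed
  finally show ?thesis .
qed

text \<open>Chebyshev's inequality for the number \<open>X\<close> of events that occur, with the
  second moment expanded into pairwise intersections.\<close>

lemma second_moment_method:
  fixes M :: "'a pmf" and A :: "'i \<Rightarrow> 'a set"
  defines "\<mu> \<equiv> \<lambda>S. measure_pmf.prob M S"
  assumes "finite I" and pos: "(\<Sum>i\<in>I. \<mu> (A i)) > 0"
  shows "\<mu> {x. \<forall>i\<in>I. x \<notin> A i} \<le> (\<Sum>i\<in>I. \<Sum>j\<in>I. \<mu> (A i \<inter> A j)) / (\<Sum>i\<in>I. \<mu> (A i))\<^sup>2 - 1"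
proof -
  define m where "m = (\<Sum>i\<in>I. \<mu> (A i))"
  define X :: "'a \<Rightarrow> real" where "X x = (\<Sum>i\<in>I. indicator (A i) x)" for x
  define B where "B = {x. \<forall>i\<in>I. x \<notin> A i}"
  have int: "integrable M (indicator S :: 'a \<Rightarrow> real)" for S
    by (rule measure_pmf.integrable_const_bound[where B = 1]) (auto simp: indicator_def)
  have EX: "integrable M X" "measure_pmf.expectation M X = m"
    using int by (auto simp: X_def[abs_def] m_def \<mu>_def)
  have X2: "(X x)\<^sup>2 = (\<Sum>i\<in>I. \<Sum>j\<in>I. indicator (A i \<inter> A j) x)" for x
    by (simp add: X_def power2_eq_square sum_product indicator_inter_arith)
  have EX2: "integrable M (\<lambda>x. (X x)\<^sup>2)"
    "measure_pmf.expectation M (\<lambda>x. (X x)\<^sup>2) = (\<Sum>i\<in>I. \<Sum>j\<in>I. \<mu> (A i \<inter> A j))"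
    using int by (auto simp: X2 \<mu>_def)
  \<comment> \<open>Integrates the pointwise bound
    \<open>m^2 * indicator B x \<le> (X x - m)^2\<close>, which is an equality on \<open>B\<close>,
    where \<open>X\<close> vanishes.\<close>
  have "m\<^sup>2 * \<mu> B = measure_pmf.expectation M (\<lambda>x. m\<^sup>2 * indicator B x)"
    by (simp add: \<mu>_def)
  also have "\<dots> \<le> measure_pmf.expectation M (\<lambda>x. (X x)\<^sup>2 - 2 * m * X x + m\<^sup>2)"
  proof (rule integral_mono)
    fix x
    show "m\<^sup>2 * indicator B x \<le> (X x)\<^sup>2 - 2 * m * X x + m\<^sup>2"
    proof (cases "x \<in> B")
      case True
      then have "X x = 0"
        by (auto simp: X_def B_def)
      then show ?thesis
        by (simp add: indicator_def)
    next
      case False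
      then show ?thesis
        using zero_le_power2[of "X x - m"] by (simp add: power2_diff algebra_simps)
    qed
  qed (use int EX EX2 in auto)
  also have "\<dots> = (\<Sum>i\<in>I. \<Sum>j\<in>I. \<mu> (A i \<inter> A j)) - m\<^sup>2"
    using EX EX2 by (simp add: power2_eq_square)
  finally have "\<mu> B \<le> ((\<Sum>i\<in>I. \<Sum>j\<in>I. \<mu> (A i \<inter> A j)) - m\<^sup>2) / m\<^sup>2"
    using pos by (simp add: m_def field_simps)
  also have "\<dots> = (\<Sum>i\<in>I. \<Sum>j\<in>I. \<mu> (A i \<inter> A j)) / m\<^sup>2 - 1"
    using pos by (simp add: m_def diff_divide_distrib)
  finally show ?thesis
    by (simp add: m_def B_def)
qed

section \<open>Counting \<open>r\<close>-subsets by their overlap with a fixed one\<close>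

lemma choose_mult_power_le:
  assumes "r \<le> n"
  shows "real (r choose i) * real n ^ i \<le> real (n choose i) * real r ^ i"
proof (cases "i \<le> r")
  case True
  \<comment> \<open>Both binomials become products over \<open>j < i\<close> and are compared factor
    by factor, by \<open>(r - j) / (n - j) \<le> r / n\<close>.\<close>
  have "real (r choose i) * real n ^ i = (\<Prod>j<i. real (r - j) / real (i - j) * real n)"
    using True unfolding prod.distrib by (simp add: binomial_altdef_of_nat atLeast0LessThan)
  also have "\<dots> \<le> (\<Prod>j<i. real (n - j) / real (i - j) * real r)"
  proof (intro prod_mono conjI)
    fix j assume j: "j \<in> {..<i}"
    have "real (r - j) * real n \<le> real (n - j) * real r"
      using j True assms by (simp add: of_nat_diff algebra_simps mult_mono)
    then show "real (r - j) / real (i - j) * real n \<le> real (n - j) / real (i - j) * real r"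
      by (simp add: divide_right_mono)
  qed simp
  also have "\<dots> = real (n choose i) * real r ^ i"
    using True assms unfolding prod.distrib by (simp add: binomial_altdef_of_nat atLeast0LessThan)
  finally show ?thesis .
next
  case False
  then have "r choose i = 0"
    by (simp add: binomial_eq_0)
  moreover have "0 \<le> real (n choose i) * real r ^ i"
    by simp
  ultimately show ?thesis
    by (simp only: of_nat_0 mult_zero_left)
qed

text \<open>Serves to bound the fraction of \<open>r\<close>-sets meeting a given one in
  \<open>i\<close> points. The identity \<open>choose_mult\<close> turns the quotient into
  \<open>(r choose i)^2 / (n choose i)\<close>; one factor \<open>r choose i\<close> is at most
  \<open>r ^ i\<close>, the other divided by \<open>n choose i\<close> is at most
  \<open>(r / n) ^ i\<close>.\<close>

lemma choose_overlap_le: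
  assumes "i \<le> r" "r \<le> n" "0 < r"
  shows "real ((r choose i) * ((n - i) choose (r - i))) / real (n choose r) \<le> (real r ^ 2 / real n) ^ i"
proof -
  have pos: "0 < n choose i" "0 < n choose r" "0 < n"
    using assms by auto
  have "real (n choose r) * real (r choose i) = real (n choose i) * real ((n - i) choose (r - i))"
    using choose_mult[OF assms(1,2)] by (metis of_nat_mult)
  then have "real ((n - i) choose (r - i)) / real (n choose r) = real (r choose i) / real (n choose i)"
    using pos by (simp add: field_simps)
  also have "\<dots> \<le> (real r / real n) ^ i"
    using choose_mult_power_le[OF assms(2), of i] pos by (simp add: field_simps)
  finally have "real (r choose i) * (real ((n - i) choose (r - i)) / real (n choose r)) \<le>
      real r ^ i * (real r / real n) ^ i"
    using binomial_le_pow[OF assms(1)]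
    by (intro mult_mono) (auto simp flip: of_nat_power)
  then show ?thesis
    by (simp add: power_mult_distrib power_divide power2_eq_square)
qed

text \<open>Choose the intersection \<open>J\<close> first, then fill it up with
  \<open>r - i\<close> points outside \<open>J\<close>. These points may still lie in
  \<open>D\<close>, so this overcounts.\<close>

lemma card_subsets_overlap_le:
  assumes "finite V" "D \<subseteq> V" "card D = r"
  shows "card {D'. D' \<subseteq> V \<and> card D' = r \<and> card (D \<inter> D') = i} \<le>
    (r choose i) * ((card V - i) choose (r - i))"
proof -
  define P where "P J = {D'. J \<subseteq> D' \<and> D' \<subseteq> V \<and> card D' = r}" for J
  have finD: "finite D"
    using assms finite_subset by blast
  have P: "card (P J) \<le> (card V - i) choose (r - i)" if J: "J \<subseteq> D" "card J = i" for J
  proof -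
    have finJ: "finite J"
      using J finD finite_subset by blast
    have "card (P J) \<le> card {X. X \<subseteq> V - J \<and> card X = r - i}"
    proof (rule card_inj_on_le[where f = "\<lambda>X. X - J"])
      show "inj_on (\<lambda>X. X - J) (P J)"
        by (auto simp: inj_on_def P_def)
      show "(\<lambda>X. X - J) ` P J \<subseteq> {X. X \<subseteq> V - J \<and> card X = r - i}"
        using finJ J by (auto simp: P_def card_Diff_subset)
    qed (use assms in simp)
    also have "\<dots> = (card V - i) choose (r - i)"
      using assms J finJ by (subst n_subsets) (auto simp: card_Diff_subset)
    finally show ?thesis .
  qed
  have "{D'. D' \<subseteq> V \<and> card D' = r \<and> card (D \<inter> D') = i} \<subseteq> (\<Union>J\<in>{J. J \<subseteq> D \<and> card J = i}. P J)"
    by (auto simp: P_def intro!: exI[of _ "D \<inter> _"])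
  moreover have "finite (P J)" for J
    using assms(1) by (auto simp: P_def intro: finite_subset[of _ "Pow V"])
  ultimately have "card {D'. D' \<subseteq> V \<and> card D' = r \<and> card (D \<inter> D') = i} \<le>
      card (\<Union>J\<in>{J. J \<subseteq> D \<and> card J = i}. P J)"
    using finD by (intro card_mono) auto
  also have "\<dots> \<le> (\<Sum>J\<in>{J. J \<subseteq> D \<and> card J = i}. card (P J))"
    using finD by (intro card_UN_le) auto
  also have "\<dots> \<le> (\<Sum>J\<in>{J. J \<subseteq> D \<and> card J = i}. (card V - i) choose (r - i))"
    using P by (intro sum_mono) auto
  also have "\<dots> = (r choose i) * ((card V - i) choose (r - i))"
    using finD assms by (simp add: n_subsets)
  finally show ?thesis .
qed

text \<open>Second moment of the number of dominating \<open>r\<close>-sets, with pairs sorted by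
  overlap \<open>i\<close>. Overlap \<open>0\<close> supplies the leading \<open>1\<close>; the
  denominator \<open>(1 - x) ^ (2 * r)\<close> pays for the vertices ignored in the estimate for
  pairs.\<close>

lemma prob_gnp_no_dominating_le:
  fixes p :: real
  assumes p: "0 < p" "p < 1" and r: "0 < r" "2 * r \<le> n"
  defines "x \<equiv> (1 - p) ^ r"
  shows "measure_pmf.prob (gnp n p)
      {E. \<forall>D\<subseteq>{1..n}. card D = r \<longrightarrow> undominated n E D \<noteq> {}} \<le>
    (1 + (\<Sum>i=1..r. (real r ^ 2 / real n) ^ i * exp (real n * x\<^sup>2 / ((1 - p) ^ i * (1 - x)\<^sup>2))))
      / (1 - x) ^ (2 * r) - 1"
proof -
  define \<mu> where "\<mu> = measure_pmf.prob (gnp n p)"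
  define I where "I = {D. D \<subseteq> {1..n} \<and> card D = r}"
  define A where "A D = {E. undominated n E D = {}}" for D
  define C where "C = real (n choose r)"
  define y where "y i = x\<^sup>2 / ((1 - p) ^ i * (1 - x)\<^sup>2)" for i
  define G where "G i = (1 - 2 * x + (1 - p) ^ (2 * r - i)) ^ (n - (2 * r - i))" for i
  have finI: "finite I"
    unfolding I_def by (rule finite_subset[of _ "Pow {1..n}"]) auto
  have cardI: "real (card I) = C"
    by (simp add: I_def n_subsets C_def)
  have x: "0 < x" "x < 1"
    using p r by (auto simp: x_def power_less_one_iff)
  have C: "C > 0"
    using r by (simp add: C_def)
  have "\<mu> (A D) = (1 - x) ^ (n - r)" if "D \<in> I" for D
    using prob_gnp_undominated_subset[of D n "{}" p] that p
    by (simp add: A_def I_def x_def \<mu>_def)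
  then have mean: "(\<Sum>D\<in>I. \<mu> (A D)) = C * (1 - x) ^ (n - r)"
    by (simp add: cardI)
  \<comment> \<open>The factor \<open>(1 - x)^2\<close> per vertex is what two independent events
    would give. The overlap adds the correlation \<open>y i\<close>, absorbed through
    \<open>1 + y i \<le> exp (y i)\<close>.\<close>
  have G_le: "G i \<le> (1 - x) ^ (2 * (n - 2 * r)) * exp (real n * y i)" if i: "i \<le> r" for i
  proof -
    have "(1 - p) ^ (2 * r - i) = x\<^sup>2 / (1 - p) ^ i"
      using p i by (simp add: x_def power_diff power_even_eq)
    also have "\<dots> = (1 - x)\<^sup>2 * y i"
      using x by (simp add: y_def)
    finally have "1 - 2 * x + (1 - p) ^ (2 * r - i) = (1 - x)\<^sup>2 * (1 + y i) - x\<^sup>2"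
      by (simp add: power2_eq_square algebra_simps)
    also have "\<dots> \<le> (1 - x)\<^sup>2 * exp (y i)"
      using exp_ge_add_one_self[of "y i"] x
      by (smt (verit) mult_left_mono zero_le_power2)
    finally have le: "1 - 2 * x + (1 - p) ^ (2 * r - i) \<le> (1 - x)\<^sup>2 * exp (y i)" .
    \<comment> \<open>\<open>power_mono\<close> asks for a nonnegative base; it is at least
      \<open>(1 - x)^2\<close>.\<close>
    have "(1 - p) ^ r * (1 - p) ^ r \<le> (1 - p) ^ (2 * r - i)"
      using p by (simp add: power_decreasing flip: power_add)
    then have "0 \<le> 1 - 2 * x + (1 - p) ^ (2 * r - i)"
      using zero_le_power2[of "1 - x"] by (simp add: x_def power2_eq_square algebra_simps)
    then have "G i \<le> ((1 - x)\<^sup>2 * exp (y i)) ^ (n - (2 * r - i))"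
      unfolding G_def using le by (intro power_mono)
    also have "\<dots> = (1 - x) ^ (2 * (n - (2 * r - i))) * exp (real (n - (2 * r - i)) * y i)"
      by (simp add: power_mult_distrib power_mult exp_of_nat_mult)
    \<comment> \<open>Lowering the exponent of \<open>1 - x\<close> makes this factor common to all
      \<open>i\<close>, so that it cancels against the squared mean.\<close>
    also have "\<dots> \<le> (1 - x) ^ (2 * (n - 2 * r)) * exp (real n * y i)"
    proof (intro mult_mono power_decreasing)
      have "real (n - (2 * r - i)) * y i \<le> real n * y i"
        using x p by (intro mult_right_mono) (auto simp: y_def)
      then show "exp (real (n - (2 * r - i)) * y i) \<le> exp (real n * y i)"
        by simp
    qed (use x in auto)
    finally show ?thesis .
  qed
  have G0: "G 0 = (1 - x) ^ (2 * (n - 2 * r))"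
  proof -
    have "1 - 2 * x + (1 - p) ^ (2 * r) = (1 - x)\<^sup>2"
      by (simp add: x_def power_even_eq power2_diff)
    then show ?thesis
      by (simp add: G_def power_mult)
  qed
  have pair: "(\<Sum>D'\<in>I. \<mu> (A D \<inter> A D')) \<le>
      C * (1 + (\<Sum>i=1..r. (real r ^ 2 / real n) ^ i * exp (real n * y i))) * (1 - x) ^ (2 * (n - 2 * r))"
    if D: "D \<in> I" for D
  proof -
    define N where "N i = {D' \<in> I. card (D \<inter> D') = i}" for i
    have fin: "finite D"
      using D finite_subset by (auto simp: I_def)
    have le_r: "card (D \<inter> D') \<le> r" for D'
      using D card_mono[OF fin, of "D \<inter> D'"] by (auto simp: I_def)
    have "(\<Sum>D'\<in>I. \<mu> (A D \<inter> A D')) = (\<Sum>i\<in>{0..r}. \<Sum>D'\<in>N i. \<mu> (A D \<inter> A D'))"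
      unfolding N_def using finI le_r by (intro sum.group[symmetric]) auto
    also have "\<dots> \<le> (\<Sum>i\<in>{0..r}. \<Sum>D'\<in>N i. G i)"
    proof (intro sum_mono)
      fix i D' assume "D' \<in> N i"
      then show "\<mu> (A D \<inter> A D') \<le> G i"
        using D prob_gnp_two_dominating_le[of D n r D' i p] p
        by (simp add: N_def I_def G_def \<mu>_def A_def x_def Collect_conj_eq)
    qed
    also have "\<dots> = (\<Sum>i\<in>{0..r}. real (card (N i)) * G i)"
      by simp
    also have "\<dots> = real (card (N 0)) * G 0 + (\<Sum>i=1..r. real (card (N i)) * G i)"
      by (simp add: sum.atLeast_Suc_atMost)
    also have "\<dots> \<le> C * G 0 + (\<Sum>i=1..r. C * (real r ^ 2 / real n) ^ i *
        ((1 - x) ^ (2 * (n - 2 * r)) * exp (real n * y i)))"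
    proof (intro add_mono sum_mono)
      have "card (N 0) \<le> card I"
        using finI by (intro card_mono) (auto simp: N_def)
      then show "real (card (N 0)) * G 0 \<le> C * G 0"
        using G0 x by (intro mult_right_mono) (auto simp flip: cardI)
    next
      fix i assume i: "i \<in> {1..r}"
      have "N i = {D'. D' \<subseteq> {1..n} \<and> card D' = r \<and> card (D \<inter> D') = i}"
        by (auto simp: N_def I_def)
      then have "real (card (N i)) \<le> real ((r choose i) * ((n - i) choose (r - i)))"
        using card_subsets_overlap_le[of "{1..n}" D r i] D unfolding of_nat_le_iff
        by (simp add: I_def)
      also have "\<dots> \<le> C * (real r ^ 2 / real n) ^ i"
        using choose_overlap_le[of i r n] i r C by (simp add: C_def field_simps)
      finally have N: "real (card (N i)) \<le> C * (real r ^ 2 / real n) ^ i" .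
      have "real (card (N i)) * G i \<le>
          real (card (N i)) * ((1 - x) ^ (2 * (n - 2 * r)) * exp (real n * y i))"
        using G_le[of i] i by (intro mult_left_mono) auto
      also have "\<dots> \<le> C * (real r ^ 2 / real n) ^ i * ((1 - x) ^ (2 * (n - 2 * r)) * exp (real n * y i))"
        using N x by (intro mult_right_mono) auto
      finally show "real (card (N i)) * G i \<le>
          C * (real r ^ 2 / real n) ^ i * ((1 - x) ^ (2 * (n - 2 * r)) * exp (real n * y i))" .
    qed
    also have "\<dots> = C * (1 + (\<Sum>i=1..r. (real r ^ 2 / real n) ^ i * exp (real n * y i))) *
        (1 - x) ^ (2 * (n - 2 * r))"
      by (simp add: G0 ring_distribs sum_distrib_left sum_distrib_right mult_ac)
    finally show ?thesis .
  qed
  define Z where "Z = 1 + (\<Sum>i=1..r. (real r ^ 2 / real n) ^ i * exp (real n * y i))"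
  have "\<mu> {E. \<forall>D\<in>I. E \<notin> A D} \<le>
      (\<Sum>D\<in>I. \<Sum>D'\<in>I. \<mu> (A D \<inter> A D')) / (\<Sum>D\<in>I. \<mu> (A D))\<^sup>2 - 1"
    unfolding \<mu>_def using finI C x
    by (intro second_moment_method) (simp_all add: mean flip: \<mu>_def)
  also have "\<dots> \<le> (\<Sum>D\<in>I. C * Z * (1 - x) ^ (2 * (n - 2 * r))) / (\<Sum>D\<in>I. \<mu> (A D))\<^sup>2 - 1"
    using pair by (intro diff_right_mono divide_right_mono sum_mono) (auto simp: Z_def)
  also have "\<dots> = Z * (1 - x) ^ (2 * (n - 2 * r)) / (1 - x) ^ (2 * (n - r)) - 1"
    using C by (simp add: mean cardI power_mult_distrib power2_eq_square power_mult mult_2 power_add)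
  also have "2 * (n - r) = 2 * (n - 2 * r) + 2 * r"
    using r by simp
  also have "Z * (1 - x) ^ (2 * (n - 2 * r)) / (1 - x) ^ (2 * (n - 2 * r) + 2 * r) = Z / (1 - x) ^ (2 * r)"
    using x by (simp add: power_add)
  finally show ?thesis
    by (simp add: Z_def y_def I_def A_def \<mu>_def imp_conjL)
qed

section \<open>Asymptotics\<close>

text \<open>\<open>a_fun\<close> in natural logarithms, with \<open>\<beta>\<close> for
  \<open>- ln (1 - p)\<close> and the logarithm of the quotient expanded: a form suited to
  \<open>real_asymp\<close>.\<close>

definition a_asymp :: "real \<Rightarrow> nat \<Rightarrow> real" where
  "a_asymp \<beta> n = (ln n - ln ((ln n)\<^sup>2 / \<beta>)) / \<beta>"

lemma a_fun_eq:
  assumes "0 < p" "p < 1" "2 \<le> n"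
  shows "a_fun p n = a_asymp (- ln (1 - p)) n"
proof -
  define \<beta> where "\<beta> = - ln (1 - p)"
  have pos: "\<beta> > 0" "ln (real n) > 0"
    using assms by (simp_all add: \<beta>_def)
  have "real n / (log (1 / (1 - p)) (real n) * ln (real n)) = real n / ((ln (real n))\<^sup>2 / \<beta>)"
    using assms by (simp add: log_def ln_div \<beta>_def power2_eq_square)
  moreover have "log (1 / (1 - p)) y = ln y / \<beta>" for y
    using assms by (simp add: log_def ln_div \<beta>_def)
  ultimately have "a_fun p n = ln (real n / ((ln (real n))\<^sup>2 / \<beta>)) / \<beta>"
    unfolding a_fun_def by metis
  also have "\<dots> = a_asymp \<beta> n"
    unfolding a_asymp_def using pos assms by (subst ln_div) auto
  finally show ?thesis
    by (simp add: \<beta>_def)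
qed

text \<open>Hence \<open>n * (1 - p) ^ a\<close>, roughly the mean number of vertices left
  undominated by \<open>a\<close> vertices, is \<open>(ln n)^2 / \<beta>\<close>. To leading order
  this equals \<open>a * ln n\<close>, the logarithm of the bound \<open>n ^ a\<close> for the
  number of \<open>a\<close>-sets: \<open>a\<close> is where the two balance.\<close>

lemma exp_a_asymp:
  assumes "\<beta> > 0" "2 \<le> n"
  shows "exp (- (\<beta> * a_asymp \<beta> n)) = (ln n)\<^sup>2 / \<beta> / n"
proof -
  have pos: "(ln (real n))\<^sup>2 / \<beta> > 0"
    using assms by simp
  have "exp (- (\<beta> * a_asymp \<beta> n)) = exp (ln ((ln n)\<^sup>2 / \<beta>) - ln n)"
    using assms by (simp add: a_asymp_def)
  also have "\<dots> = (ln n)\<^sup>2 / \<beta> / n"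
    using pos assms by (simp add: exp_diff del: ln_div)
  finally show ?thesis .
qed

text \<open>With \<open>d = a - k\<close>, the mean number of undominated vertices is about
  \<open>exp (\<beta> * d) * N^2 / \<beta>\<close>. Its value at \<open>d = 0\<close> beats the cost
  \<open>a * N\<close> of choosing \<open>D\<close> by \<open>C3\<close>; its growth in
  \<open>d\<close> beats the cost \<open>K * d * N\<close> of choosing the exceptional vertices by
  \<open>C2\<close>.\<close>

lemma first_moment_term_le:
  fixes \<beta> K a n N :: real and k j m :: nat
  assumes \<beta>: "\<beta> > 0" and n: "n > 0" and "K \<ge> 0" and N: "n = exp N" "N \<ge> 0"
    and a: "exp (- (\<beta> * a)) = N\<^sup>2 / \<beta> / n"
    and k: "real k \<le> a" and j: "real j \<le> K * (a - k)" and m: "real m \<ge> n - k - j"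
    and C1: "(1 + K) * a / n \<le> 1 / 2" and C2: "K * N \<le> N\<^sup>2 / 2"
    and C3: "a * N - N\<^sup>2 / \<beta> * (1 - (1 + K) * a / n) \<le> - N"
  shows "n ^ (k + j) * (1 - exp (- \<beta>) ^ k) ^ m \<le> exp (- N)"
proof -
  define d where "d = a - real k"
  \<comment> \<open>Bounds the fraction of vertices among the \<open>k + j\<close> chosen ones,
    uniformly in \<open>k\<close> and \<open>j\<close>.\<close>
  define \<eta> where "\<eta> = (1 + K) * a / n"
  define q where "q = exp (- \<beta>) ^ k"
  have \<eta>_le: "\<eta> \<le> 1 / 2"
    using C1 by (simp only: \<eta>_def)
  have d: "d \<ge> 0"
    using k by (simp add: d_def)
  have q: "0 < q" "q \<le> 1"
    using \<beta> by (simp_all add: q_def power_le_one)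
  have "0 \<le> K * real k" "real j \<le> K * a - K * real k" "(1 + K) * a = a + K * a"
    using j \<open>K \<ge> 0\<close> by (simp_all add: algebra_simps)
  then have kj: "real k + real j \<le> (1 + K) * a"
    using k by linarith
  have "n * (1 - \<eta>) \<le> real m"
  proof -
    have "n * (1 - \<eta>) = n - (1 + K) * a"
      using n by (simp add: \<eta>_def right_diff_distrib)
    then show ?thesis
      using m kj by linarith
  qed
  then have "q * n * (1 - \<eta>) \<le> q * real m"
    using q unfolding mult.assoc by (intro mult_left_mono) auto
  moreover have "q * n = exp (\<beta> * d) * (N\<^sup>2 / \<beta>)"
  proof -
    have "q = exp (\<beta> * d) * exp (- (\<beta> * a))"
      by (simp add: q_def d_def algebra_simps flip: exp_of_nat_mult exp_add)
    then show ?thesis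
      using n by (simp add: a)
  qed
  \<comment> \<open>The linear part of the exponential suffices, since the cost of the exceptional
    vertices is itself linear in \<open>d\<close>.\<close>
  moreover have "(1 + \<beta> * d) * (N\<^sup>2 / \<beta>) * (1 - \<eta>) \<le> exp (\<beta> * d) * (N\<^sup>2 / \<beta>) * (1 - \<eta>)"
    using \<eta>_le \<beta> by (intro mult_right_mono) auto
  ultimately have qm: "(1 + \<beta> * d) * (N\<^sup>2 / \<beta>) * (1 - \<eta>) \<le> q * real m"
    by (metis order_trans)
  have "K * N \<le> N\<^sup>2 * (1 - \<eta>)"
    using C2 mult_left_mono[of "1/2" "1 - \<eta>" "N\<^sup>2"] \<eta>_le by simp
  then have "d * (K * N) \<le> d * (N\<^sup>2 * (1 - \<eta>))"
    using d by (rule mult_left_mono)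
  moreover have "(real k + real j) * N \<le> (a + d * K - d) * N"
    using j N by (intro mult_right_mono) (auto simp: d_def algebra_simps)
  moreover have "(1 + \<beta> * d) * (N\<^sup>2 / \<beta>) * (1 - \<eta>) =
      N\<^sup>2 / \<beta> * (1 - \<eta>) + d * (N\<^sup>2 * (1 - \<eta>))"
    using \<beta> by (simp add: field_simps)
  moreover have "0 \<le> d * N"
    using d N by simp
  ultimately have exponent: "(real k + real j) * N - q * real m \<le> - N"
    using C3 qm unfolding \<eta>_def[symmetric] by (simp add: algebra_simps)
  have "(1 - q) ^ m \<le> exp (- q) ^ m"
    using q exp_ge_add_one_self[of "- q"] by (intro power_mono) auto
  also have "\<dots> = exp (- (q * real m))"
    by (simp add: mult.commute flip: exp_of_nat_mult)
  finally have "n ^ (k + j) * (1 - q) ^ m \<le> exp N ^ (k + j) * exp (- (q * real m))"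
    unfolding N by (intro mult_left_mono) auto
  also have "\<dots> = exp ((real k + real j) * N - q * real m)"
    by (simp flip: exp_of_nat_mult exp_add)
  also have "\<dots> \<le> exp (- N)"
    using exponent by simp
  finally show ?thesis
    by (simp add: q_def)
qed

text \<open>Only about \<open>(ln n)^2\<close> pairs \<open>(k, j)\<close> are admissible, up to a
  constant, and each contributes at most \<open>1 / n\<close>.\<close>

lemma prob_gnp_few_undominated_tendsto_0:
  fixes p K :: real
  assumes p: "0 < p" "p < 1" and K: "K \<ge> 0"
  shows "(\<lambda>n. measure_pmf.prob (gnp n p) {E. \<exists>D\<subseteq>{1..n}. real (card D) \<le> a_fun p n \<and>
    real (card (undominated n E D)) \<le> K * (a_fun p n - real (card D))}) \<longlonglongrightarrow> 0"
proof -
  define \<beta> where "\<beta> = - ln (1 - p)"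
  have \<beta>: "\<beta> > 0"
    using p by (simp add: \<beta>_def)
  define a where "a = a_asymp \<beta>"
  define P where "P n = measure_pmf.prob (gnp n p) {E. \<exists>D\<subseteq>{1..n}. real (card D) \<le> a_fun p n \<and>
    real (card (undominated n E D)) \<le> K * (a_fun p n - real (card D))}" for n
  have C: "eventually (\<lambda>n. (1 + K) * a n / n \<le> 1/2) sequentially"
    "eventually (\<lambda>n::nat. K * ln n \<le> (ln n)\<^sup>2 / 2) sequentially"
    "eventually (\<lambda>n. a n * ln n - (ln n)\<^sup>2 / \<beta> * (1 - (1 + K) * a n / n) \<le> - ln n) sequentially"
    "eventually (\<lambda>n. a n \<ge> 0) sequentially"
    unfolding a_def a_asymp_def using \<beta> K by real_asymp+
  have "eventually (\<lambda>n. P n \<le> (a n + 1) * (K * a n + 1) * exp (- ln n)) sequentially"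
    using C eventually_ge_at_top[of 2]
  proof eventually_elim
    case (elim n)
    have a: "a_fun p n = a n"
      using a_fun_eq[OF p elim(5)] by (simp add: a_def \<beta>_def)
    have ea: "exp (- (\<beta> * a n)) = (ln n)\<^sup>2 / \<beta> / n"
      using exp_a_asymp[OF \<beta> elim(5)] by (simp add: a_def)
    have q: "1 - p = exp (- \<beta>)"
      using p by (simp add: \<beta>_def)
    define I where "I = {(k, j). real k \<le> a n \<and> real j \<le> K * (a n - real k)}"
    have I: "I \<subseteq> {..nat \<lfloor>a n\<rfloor>} \<times> {..nat \<lfloor>K * a n\<rfloor>}"
    proof
      fix x assume "x \<in> I"
      then obtain k j where x: "x = (k, j)" "real k \<le> a n" "real j \<le> K * (a n - real k)"
        by (auto simp: I_def)
      moreover have "K * (a n - real k) \<le> K * a n"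
        using K by (intro mult_left_mono) auto
      ultimately show "x \<in> {..nat \<lfloor>a n\<rfloor>} \<times> {..nat \<lfloor>K * a n\<rfloor>}"
        by (auto simp: le_nat_floor)
    qed
    then have finI: "finite I"
      by (rule finite_subset) auto
    have "card I \<le> card ({..nat \<lfloor>a n\<rfloor>} \<times> {..nat \<lfloor>K * a n\<rfloor>})"
      using I by (intro card_mono) auto
    then have "real (card I) \<le> real (Suc (nat \<lfloor>a n\<rfloor>) * Suc (nat \<lfloor>K * a n\<rfloor>))"
      by (simp add: card_cartesian_product flip: of_nat_mult del: of_nat_Suc mult_Suc mult_Suc_right)
    also have "\<dots> \<le> (a n + 1) * (K * a n + 1)"
      unfolding of_nat_mult using elim(4) K
      by (intro mult_mono) (auto simp: add.commute of_nat_floor)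
    finally have cardI: "real (card I) \<le> (a n + 1) * (K * a n + 1)" .
    have "P n = measure_pmf.prob (gnp n p) {E. \<exists>D\<subseteq>{1..n}. (card D, card (undominated n E D)) \<in> I}"
      by (simp add: P_def I_def a)
    also have "\<dots> \<le> (\<Sum>(k, j)\<in>I. real n ^ (k + j) * (1 - (1 - p) ^ k) ^ (n - k - j))"
      using finI p by (intro prob_gnp_few_undominated_le) auto
    also have "\<dots> \<le> (\<Sum>(k, j)\<in>I. exp (- ln n))"
    proof (intro sum_mono, clarify)
      fix k j assume "(k, j) \<in> I"
      then show "real n ^ (k + j) * (1 - (1 - p) ^ k) ^ (n - k - j) \<le> exp (- ln n)"
        using elim ea K \<beta> unfolding q
        by (intro first_moment_term_le[where K = K and a = "a n"]) (auto simp: I_def)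
    qed
    also have "\<dots> = real (card I) * exp (- ln n)"
      by (simp add: case_prod_unfold)
    also have "\<dots> \<le> (a n + 1) * (K * a n + 1) * exp (- ln n)"
      using cardI by (intro mult_right_mono) auto
    finally show ?case .
  qed
  moreover have "(\<lambda>n. (a n + 1) * (K * a n + 1) * exp (- ln n)) \<longlonglongrightarrow> 0"
    unfolding a_def a_asymp_def using \<beta> K by real_asymp
  ultimately have "P \<longlonglongrightarrow> 0"
    by (rule tendsto_sandwich[OF _ _ tendsto_const, rotated]) (auto simp: P_def)
  then show ?thesis
    by (simp add: P_def[abs_def])
qed

section \<open>Asymptotics of the second moment\<close>

text \<open>
  The term of overlap \<open>i\<close> in the second moment has an exponent that is convex in \<open>i\<close>, so only the
  overlaps \<open>1\<close> and \<open>r\<close> have to be estimated.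
\<close>

lemma overlap_exponent_le:
  fixes \<beta> \<theta> M N r i :: real
  assumes "\<beta> > 0" "0 \<le> \<theta>" "0 \<le> M" and i: "1 \<le> i" "i \<le> r"
    and "2 * ln r - N + \<theta> * M * exp (\<beta> * (1 - r)) \<le> u"
    and "r * (2 * ln r - N) + \<theta> * M \<le> u"
  shows "i * (2 * ln r - N) + \<theta> * M * exp (\<beta> * (i - r)) \<le> u"
\<comment> \<open>For \<open>r = 1\<close> the only overlap is \<open>i = 1\<close>; otherwise the
  weights below divide by \<open>r - 1\<close>.\<close>
proof (cases "r = 1")
  case True
  then show ?thesis
    using assms by simp
next
  case False
  define h where "h y = y * (2 * ln r - N) + \<theta> * M * exp (\<beta> * (y - r))" for y
  have "convex_on UNIV h"
  proof (rule f''_ge0_imp_convex)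
    show "(h has_real_derivative 2 * ln r - N + \<theta> * M * \<beta> * exp (\<beta> * (y - r))) (at y)" for y
      unfolding h_def[abs_def] by (auto intro!: derivative_eq_intros)
    show "((\<lambda>y. 2 * ln r - N + \<theta> * M * \<beta> * exp (\<beta> * (y - r))) has_real_derivative
        \<theta> * M * \<beta> * \<beta> * exp (\<beta> * (y - r))) (at y)" for y
      by (auto intro!: derivative_eq_intros)
  qed (use assms in auto)
  \<comment> \<open>Weights exhibiting \<open>i\<close> as a convex combination of \<open>1\<close>
    and \<open>r\<close>; this \<open>u\<close> is not the bound \<open>u\<close> of the
    statement.\<close>
  moreover define u v where "u = (r - i) / (r - 1)" and "v = (i - 1) / (r - 1)"
  moreover have "0 \<le> u" "0 \<le> v" "u + v = 1"
    using i False by (simp_all add: u_def v_def flip: add_divide_distrib)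
  moreover have "u *\<^sub>R 1 + v *\<^sub>R r = (u + v) + v * (r - 1)"
    by (simp add: algebra_simps)
  then have "u *\<^sub>R 1 + v *\<^sub>R r = i"
    using False \<open>u + v = 1\<close> by (simp add: v_def)
  ultimately have "h i \<le> max (h 1) (h r)"
    using convex_lower[of UNIV h 1 r u v] by auto
  then show ?thesis
    using assms by (auto simp: h_def)
qed

text \<open>The margin \<open>\<delta>\<close> makes \<open>n * x\<close> at most
  \<open>\<theta>^2 * M\<close> with \<open>\<theta> = exp (- (\<beta> * \<delta> / 2))\<close> and
  \<open>M = N^2 / \<beta>\<close>. One factor \<open>\<theta>\<close> pays for the denominator
  \<open>(1 - x)^2\<close>, the other is kept as a gain in the exponent.\<close>

lemma second_moment_term_le:
  fixes \<beta> \<delta> a N x :: real and n r i :: nat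
  defines "x \<equiv> exp (- \<beta>) ^ r"
  assumes \<beta>: "\<beta> > 0" and \<delta>: "\<delta> > 0" and n: "real n = exp N"
    and a: "exp (- (\<beta> * a)) = N\<^sup>2 / \<beta> / n" "a \<ge> 1"
    and r: "a + \<delta> \<le> r" "r \<le> a + 2" and i: "1 \<le> i" "i \<le> r"
    and C1: "2 * ln (a + 2) - N + exp \<beta> * (N\<^sup>2 / \<beta>)\<^sup>2 / n \<le> - N / 2"
    and C2: "N - 2 * ln (a + 2) \<ge> 0"
    and C3: "2 * (N\<^sup>2 / \<beta> / n) \<le> 1 - exp (- (\<beta> * \<delta> / 2))"
    and C4: "exp (- (\<beta> * \<delta> / 2)) * (N\<^sup>2 / \<beta>) - a * (N - 2 * ln (a + 2)) \<le> - N / 2"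
  shows "(real r ^ 2 / n) ^ i * exp (n * x\<^sup>2 / (exp (- \<beta>) ^ i * (1 - x)\<^sup>2)) \<le> exp (- N / 2)"
proof -
  define M where "M = N\<^sup>2 / \<beta>"
  define \<theta> where "\<theta> = exp (- (\<beta> * \<delta> / 2))"
  have \<theta>: "0 < \<theta>" "\<theta> < 1"
    using \<beta> \<delta> by (simp_all add: \<theta>_def)
  have M: "0 \<le> M"
    using \<beta> by (simp add: M_def)
  have npos: "real n > 0"
    using n by simp
  have x_eq: "x = exp (- (\<beta> * r))"
    by (simp add: x_def mult.commute flip: exp_of_nat_mult)
  have "x \<le> exp (- (\<beta> * (a + \<delta>)))"
    using \<beta> r by (simp add: x_eq)
  also have "\<dots> = exp (- (\<beta> * a)) * exp (- (\<beta> * \<delta>))"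
    by (simp add: ring_distribs flip: exp_add)
  also have "exp (- (\<beta> * \<delta>)) = \<theta>\<^sup>2"
    by (simp add: \<theta>_def flip: exp_of_nat_mult)
  finally have x_le: "x \<le> M / n * \<theta>\<^sup>2"
    using a by (simp add: M_def)
  have "M / n * \<theta>\<^sup>2 \<le> M / n * 1"
    using \<theta> M by (intro mult_left_mono power_le_one) auto
  then have x_le': "x \<le> M / n"
    using x_le by simp
  have "\<theta> \<le> 1 - 2 * x"
    using C3 x_le' by (simp add: M_def \<theta>_def)
  also have "\<dots> \<le> (1 - x)\<^sup>2"
    by (simp add: power2_diff)
  finally have \<theta>_le: "\<theta> \<le> (1 - x)\<^sup>2" .
  have ln_r: "ln r \<le> ln (a + 2)" "ln r \<ge> 0"
    using r a \<delta> by auto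
  have "n * x\<^sup>2 / (exp (- \<beta>) ^ i * (1 - x)\<^sup>2) \<le> n * x\<^sup>2 / (exp (- \<beta>) ^ i * \<theta>)"
    using \<theta>_le \<theta> by (intro divide_left_mono mult_left_mono mult_pos_pos) auto
  also have "\<dots> = n * x * exp (\<beta> * (real i - r)) / \<theta>"
  proof -
    have "exp (\<beta> * (real i - r)) = x / exp (- \<beta>) ^ i"
      by (simp add: x_eq algebra_simps flip: exp_of_nat_mult exp_diff)
    then show ?thesis
      by (simp add: power2_eq_square)
  qed
  also have "\<dots> \<le> (M * \<theta>\<^sup>2) * exp (\<beta> * (real i - r)) / \<theta>"
    using x_le npos \<theta> by (intro divide_right_mono mult_right_mono) (auto simp: field_simps)
  also have "\<dots> = \<theta> * M * exp (\<beta> * (real i - r))"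
    using \<theta> by (simp add: power2_eq_square)
  finally have "(real r ^ 2 / n) ^ i * exp (n * x\<^sup>2 / (exp (- \<beta>) ^ i * (1 - x)\<^sup>2)) \<le>
      (real r ^ 2 / n) ^ i * exp (\<theta> * M * exp (\<beta> * (real i - r)))"
    by (intro mult_left_mono) auto
  also have "(real r ^ 2 / n) ^ i * exp (\<theta> * M * exp (\<beta> * (real i - r))) =
      exp (real i * (2 * ln r - N) + \<theta> * M * exp (\<beta> * (real i - r)))"
  proof -
    have "real r ^ 2 / n = exp (2 * ln r - N)"
      using r a \<delta> by (simp add: n exp_diff exp_double)
    then show ?thesis
      by (simp add: exp_add flip: exp_of_nat_mult)
  qed
  also have "\<dots> \<le> exp (- N / 2)"
    unfolding exp_le_cancel_iff
  proof (rule overlap_exponent_le[OF \<beta>])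
    \<comment> \<open>Overlap \<open>1\<close>: the correlation term is at most of order
      \<open>N^4 / n\<close>.\<close>
    have "\<theta> * M * exp (\<beta> * (1 - real r)) \<le> 1 * M * exp (\<beta> * (1 - real r))"
      using \<theta> M by (intro mult_right_mono) auto
    also have "\<dots> = M * (exp \<beta> * x)"
      by (simp add: x_eq algebra_simps flip: exp_add)
    also have "\<dots> \<le> M * (exp \<beta> * (M / n))"
      using M x_le' by (intro mult_left_mono) auto
    also have "\<dots> = exp \<beta> * (N\<^sup>2 / \<beta>)\<^sup>2 / n"
      by (simp add: M_def power2_eq_square mult_ac)
    finally show "2 * ln r - N + \<theta> * M * exp (\<beta> * (1 - real r)) \<le> - N / 2"
      using C1 ln_r by linarith
    \<comment> \<open>Overlap \<open>r\<close>, the same set twice: \<open>C4\<close> relies on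
      \<open>\<theta> < 1\<close>, since \<open>N^2 / \<beta>\<close> and
      \<open>a * (N - 2 * ln (a + 2))\<close> agree to leading order.\<close>
    have "a * (N - 2 * ln (a + 2)) \<le> r * (N - 2 * ln r)"
      using C2 a r \<delta> ln_r by (intro mult_mono) auto
    then show "r * (2 * ln r - N) + \<theta> * M \<le> - N / 2"
      using C4 by (simp add: M_def \<theta>_def algebra_simps)
  qed (use i \<theta> M in auto)
  finally show ?thesis .
qed

text \<open>The \<open>r n\<close> overlaps, at most \<open>a + 2\<close> in number, contribute at
  most \<open>1 / sqrt n\<close> each, and the denominator tends to \<open>1\<close> because
  \<open>r * x\<close> tends to \<open>0\<close>.\<close>

lemma prob_gnp_no_dominating_tendsto_0:
  fixes p \<delta> :: real and r :: "nat \<Rightarrow> nat"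
  assumes p: "0 < p" "p < 1" and \<delta>: "\<delta> > 0"
    and r: "eventually (\<lambda>n. a_fun p n + \<delta> \<le> r n \<and> r n \<le> a_fun p n + 2) sequentially"
  shows "(\<lambda>n. measure_pmf.prob (gnp n p)
    {E. \<forall>D\<subseteq>{1..n}. card D = r n \<longrightarrow> undominated n E D \<noteq> {}}) \<longlonglongrightarrow> 0"
proof -
  define \<beta> where "\<beta> = - ln (1 - p)"
  have \<beta>: "\<beta> > 0"
    using p by (simp add: \<beta>_def)
  define a where "a = a_asymp \<beta>"
  define P where "P n = measure_pmf.prob (gnp n p)
    {E. \<forall>D\<subseteq>{1..n}. card D = r n \<longrightarrow> undominated n E D \<noteq> {}}" for n
  define M where "M n = (ln n)\<^sup>2 / \<beta> / n" for n :: nat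
  define \<theta> where "\<theta> = exp (- (\<beta> * \<delta> / 2))"
  have \<theta>: "0 < \<theta>" "\<theta> < 1"
    using \<beta> \<delta> by (simp_all add: \<theta>_def)
  have C: "eventually (\<lambda>n. 2 * ln (a n + 2) - ln n + exp \<beta> * ((ln n)\<^sup>2 / \<beta>)\<^sup>2 / n \<le> - ln n / 2) sequentially"
    "eventually (\<lambda>n. ln n - 2 * ln (a n + 2) \<ge> 0) sequentially"
    "eventually (\<lambda>n. 2 * M n \<le> 1 - \<theta>) sequentially"
    "eventually (\<lambda>n. \<theta> * ((ln n)\<^sup>2 / \<beta>) - a n * (ln n - 2 * ln (a n + 2)) \<le> - ln n / 2) sequentially"
    "eventually (\<lambda>n. 2 * (a n + 2) \<le> n) sequentially"
    "eventually (\<lambda>n. 2 * (a n + 2) * M n < 1) sequentially"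
    "eventually (\<lambda>n. a n \<ge> 1) sequentially"
    unfolding a_def a_asymp_def M_def using \<beta> \<theta> by real_asymp+
  have "eventually (\<lambda>n. P n \<le> (1 + (a n + 2) * exp (- ln n / 2)) / (1 - 2 * (a n + 2) * M n) - 1)
      sequentially"
    using C r eventually_ge_at_top[of 2]
  proof eventually_elim
    case (elim n)
    have a: "a_fun p n = a n"
      using a_fun_eq[OF p elim(9)] by (simp add: a_def \<beta>_def)
    have ea: "exp (- (\<beta> * a n)) = M n"
      using exp_a_asymp[OF \<beta> elim(9)] by (simp add: a_def M_def)
    have q: "1 - p = exp (- \<beta>)"
      using p by (simp add: \<beta>_def)
    have r: "a n + \<delta> \<le> r n" "r n \<le> a n + 2" "0 < r n" "2 * r n \<le> n"
      using elim a \<delta> by auto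
    define x where "x = exp (- \<beta>) ^ r n"
    have "x = exp (- (\<beta> * r n))"
      by (simp add: x_def mult.commute flip: exp_of_nat_mult)
    also have "\<dots> \<le> M n"
      using r \<delta> \<beta> by (simp flip: ea)
    finally have x: "0 < x" "x \<le> M n"
      by (simp_all add: x_def)
    have rx: "2 * real (r n) * x \<le> 2 * (a n + 2) * M n"
      using r x \<delta> elim(7) by (intro mult_mono) auto
    have "x \<le> 2 * real (r n) * x"
      using r x by simp
    then have "x < 1"
      using rx elim(6) by linarith
    have "1 - 2 * (a n + 2) * M n \<le> 1 + real (2 * r n) * (- x)"
      using rx by simp
    also have "\<dots> \<le> (1 + (- x)) ^ (2 * r n)"
      using \<open>x < 1\<close> by (intro Bernoulli_inequality) auto
    finally have den: "1 - 2 * (a n + 2) * M n \<le> (1 - x) ^ (2 * r n)"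
      by simp
    have "P n \<le> (1 + (\<Sum>i=1..r n. (real (r n) ^ 2 / real n) ^ i *
        exp (real n * x\<^sup>2 / (exp (- \<beta>) ^ i * (1 - x)\<^sup>2)))) / (1 - x) ^ (2 * r n) - 1"
      using prob_gnp_no_dominating_le[OF p r(3,4)] by (simp add: P_def x_def q)
    also have "\<dots> \<le> (1 + (\<Sum>i=1..r n. exp (- ln n / 2))) / (1 - x) ^ (2 * r n) - 1"
    proof (intro diff_right_mono divide_right_mono add_left_mono sum_mono)
      fix i assume "i \<in> {1..r n}"
      then show "(real (r n) ^ 2 / real n) ^ i *
          exp (real n * x\<^sup>2 / (exp (- \<beta>) ^ i * (1 - x)\<^sup>2)) \<le> exp (- ln n / 2)"
        unfolding x_def using elim r ea \<beta> \<delta>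
        by (intro second_moment_term_le[where a = "a n" and \<delta> = \<delta>]) (auto simp: M_def \<theta>_def)
    qed (use \<open>x < 1\<close> in auto)
    also have "\<dots> = (1 + r n * exp (- ln n / 2)) / (1 - x) ^ (2 * r n) - 1"
      by simp
    also have "\<dots> \<le> (1 + (a n + 2) * exp (- ln n / 2)) / (1 - 2 * (a n + 2) * M n) - 1"
      using den elim r \<delta> by (intro diff_right_mono frac_le add_left_mono mult_right_mono) auto
    finally show ?case .
  qed
  moreover have "(\<lambda>n. (1 + (a n + 2) * exp (- ln n / 2)) / (1 - 2 * (a n + 2) * M n) - 1) \<longlonglongrightarrow> 0"
    unfolding a_def a_asymp_def M_def using \<beta> by real_asymp
  ultimately have "P \<longlonglongrightarrow> 0"
    by (rule tendsto_sandwich[OF _ _ tendsto_const, rotated]) (auto simp: P_def)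
  then show ?thesis
    by (simp add: P_def[abs_def])
qed

section \<open>The self domination number\<close>

lemma SUP_nbhd_ge_1_iff:
  assumes c: "(c :: ennreal) < 1" and f: "\<And>v. v \<in> V \<Longrightarrow> f v \<in> {0, 1, c}"
  shows "(SUP v\<in>nbhd V E u. f v) \<ge> 1 \<longleftrightarrow> (\<exists>v\<in>V. f v = 1 \<and> {u, v} \<in> E)"
proof
  assume ge: "(SUP v\<in>nbhd V E u. f v) \<ge> 1"
  show "\<exists>v\<in>V. f v = 1 \<and> {u, v} \<in> E"
  proof (rule ccontr)
    assume "\<not> ?thesis"
    \<comment> \<open>Every value other than \<open>1\<close> is at most \<open>c\<close>, so
      \<open>c\<close> is a common bound that keeps the supremum strictly below
      \<open>1\<close>.\<close>
    then have "f v \<le> c" if "v \<in> nbhd V E u" for v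
      using f[of v] that by (auto simp: nbhd_def)
    then have "(SUP v\<in>nbhd V E u. f v) \<le> c"
      by (rule SUP_least)
    then show False
      using ge c by auto
  qed
next
  assume "\<exists>v\<in>V. f v = 1 \<and> {u, v} \<in> E"
  then show "(SUP v\<in>nbhd V E u. f v) \<ge> 1"
    by (auto simp: nbhd_def intro: SUP_upper2)
qed

text \<open>Take a minimiser with values in \<open>{0, 1, c}\<close>, \<open>D\<close> its level set
  at \<open>1\<close>, and \<open>m\<close> the number of vertices of value \<open>c\<close>. An
  undominated vertex has no neighbour of value \<open>1\<close>, so it must carry \<open>c\<close>
  itself.\<close>

lemma self_dom_number_eq:
  fixes c :: real
  assumes c: "0 < c" "c < 1"
  obtains D m where "D \<subseteq> {1..n}" "card (undominated n E D) \<le> m"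
    "self_dom_number (ennreal c) {1..n} E = ennreal (real (card D) + c * real m)"
proof -
  obtain f where sd: "self_dominating (ennreal c) {1..n} E f"
    and f: "\<And>u. u \<in> {1..n} \<Longrightarrow> f u \<in> {0, 1, ennreal c}"
    and w: "weight {1..n} f = self_dom_number (ennreal c) {1..n} E"
    by (rule self_dom_number_attained[of "{1..n}" "ennreal c" E]) auto
  define D C where "D = {u \<in> {1..n}. f u = 1}" and "C = {u \<in> {1..n}. f u = ennreal c}"
  have c': "0 < ennreal c" "ennreal c < 1"
    using c by (simp_all add: ennreal_less_one_iff)
  have "u \<in> C" if u: "u \<in> undominated n E D" for u
  proof -
    have "u \<in> {1..n}" "f u \<noteq> 1" "\<not> (\<exists>v\<in>{1..n}. f v = 1 \<and> {u, v} \<in> E)"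
      using u by (auto simp: undominated_def D_def)
    moreover have "(SUP v\<in>nbhd {1..n} E u. f v) \<ge> 1 \<longleftrightarrow> (\<exists>v\<in>{1..n}. f v = 1 \<and> {u, v} \<in> E)"
      using c' f by (intro SUP_nbhd_ge_1_iff) auto
    moreover have "f u \<ge> ennreal c \<or> (SUP v\<in>nbhd {1..n} E u. f v) \<ge> 1"
      using sd \<open>u \<in> {1..n}\<close> unfolding self_dominating_def by (rule bspec)
    ultimately have "u \<in> {1..n}" "f u \<noteq> 1" "f u \<ge> ennreal c"
      by blast+
    then show ?thesis
      using f[of u] c' by (auto simp: C_def)
  qed
  then have "card (undominated n E D) \<le> card C"
    by (intro card_mono) (auto simp: C_def)
  moreover have "weight {1..n} f = (\<Sum>u\<in>{1..n}. (if u \<in> D then 1 else 0) + (if u \<in> C then ennreal c else 0))"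
    unfolding weight_def
  proof (intro sum.cong refl)
    fix u assume "u \<in> {1..n}"
    then show "f u = (if u \<in> D then 1 else 0) + (if u \<in> C then ennreal c else 0)"
      using f[of u] c' by (auto simp: D_def C_def)
  qed
  then have "weight {1..n} f = ennreal (real (card D) + c * real (card C))"
    using c by (simp add: sum.distrib D_def C_def sum.If_cases Int_def ennreal_plus
      ennreal_mult ennreal_of_nat_eq_real_of_nat mult.commute)
  moreover have "D \<subseteq> {1..n}"
    by (auto simp: D_def)
  ultimately show ?thesis
    using that[of D "card C"] w by simp
qed

lemma self_dom_number_le_card:
  assumes "D \<subseteq> {1..n}" "undominated n E D = {}" "c \<le> 1"
  shows "self_dom_number c {1..n} E \<le> of_nat (card D)"
proof -
  define g :: "nat \<Rightarrow> ennreal" where "g = indicator D"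
  have "g u \<ge> c \<or> (SUP v\<in>nbhd {1..n} E u. g v) \<ge> 1" if u: "u \<in> {1..n}" for u
  proof (cases "u \<in> D")
    case True
    then show ?thesis
      using assms(3) by (simp add: g_def)
  next
    case False
    then obtain v where "v \<in> D" "{u, v} \<in> E"
      using u assms(2) by (auto simp: undominated_def)
    then show ?thesis
      using assms(1) by (auto simp: nbhd_def g_def intro!: SUP_upper2[of v])
  qed
  then have sd: "self_dominating c {1..n} E g"
    by (simp add: self_dominating_def)
  have "self_dom_number c {1..n} E \<le> weight {1..n} g"
    by (rule self_dom_number_attained[of "{1..n}" c E]) (use sd in auto)
  also have "\<dots> = of_nat (card D)"
    using assms(1) by (simp add: weight_def g_def indicator_def sum.If_cases Int_absorb1)
  finally show ?thesis .
qed

text \<open>The deterministic part: \<open>few\<close> yields the lower bound and excludes the gap,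
  \<open>dom\<close> yields the upper bound.\<close>

lemma self_dom_number_in_range:
  fixes s t B :: int and a :: real and n :: nat
  defines "B \<equiv> \<lfloor>floor_frac t a + 1 / of_int t\<rfloor> + 1"
  defines "\<gamma> \<equiv> \<lambda>E. self_dom_number (ennreal (of_int s / of_int t)) {1..n} E"
  assumes st: "2 \<le> s" "s \<le> t - 1"
    and few: "\<And>D. D \<subseteq> {1..n} \<Longrightarrow> real (card D) \<le> a \<Longrightarrow>
      real (card (undominated n E D)) > 3 * of_int t / of_int s * (a - real (card D))"
    and dom: "D0 \<subseteq> {1..n}" "int (card D0) = B" "undominated n E D0 = {}"
  shows "enn2ereal (\<gamma> E) \<in> ereal ` ({floor_frac t a + 1 / of_int t .. of_int B} -
    {of_int B - of_int i / of_int t | i :: int. t - s + 1 \<le> i \<and> i \<le> t - 1})"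
proof -
  define c where "c = real_of_int s / real_of_int t"
  have t: "0 < t" and c: "0 < c" "c < 1"
    using st by (auto simp: c_def)
  obtain D m where D: "D \<subseteq> {1..n}" "card (undominated n E D) \<le> m"
    and \<gamma>: "\<gamma> E = ennreal (real (card D) + c * real m)"
    unfolding \<gamma>_def c_def[symmetric] by (rule self_dom_number_eq[OF c])
  define k where "k = card D"
  define w where "w = real k + c * real m"
  \<comment> \<open>The weight times \<open>t\<close> is an integer, so \<open>w > a\<close>
    improves to the first multiple of \<open>1 / t\<close> above
    \<open>floor_frac t a\<close>.\<close>
  define Z where "Z = int k * t + s * int m"
  have w: "w \<ge> 0" "\<gamma> E = ennreal w"
    using c \<gamma> by (auto simp: w_def k_def)
  have Z: "of_int Z = w * of_int t"
    using t by (simp add: Z_def w_def c_def field_simps)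
  have few': "\<not> c * real m \<le> 3 * (a - real k)" if "real k \<le> a"
  proof -
    have "3 * (a - real k) / c = 3 * of_int t / of_int s * (a - real k)"
      by (simp add: c_def)
    also have "\<dots> < real (card (undominated n E D))"
      using few[OF D(1)] that unfolding k_def by blast
    also have "\<dots> \<le> real m"
      using D(2) by simp
    finally show ?thesis
      using c by (simp add: field_simps)
  qed
  have fl: "floor_frac t a = of_int \<lfloor>of_int t * a\<rfloor> / of_int t"
    using t by (rule floor_frac_eq)
  have "a < w"
  proof (rule ccontr)
    assume "\<not> a < w"
    moreover have "0 \<le> c * real m"
      using c by simp
    ultimately show False
      using few' by (simp add: w_def)
  qed
  then have "of_int t * a < of_int Z"
    using t by (simp add: Z)
  then have "\<lfloor>of_int t * a\<rfloor> + 1 \<le> Z"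
    by (simp add: floor_less_iff add1_zle_eq)
  then have "real_of_int (\<lfloor>of_int t * a\<rfloor> + 1) \<le> w * of_int t"
    unfolding Z[symmetric] by (simp only: of_int_le_iff)
  then have lower: "floor_frac t a + 1 / of_int t \<le> w"
    using t by (simp add: fl field_simps)
  have "ennreal w \<le> ennreal (of_int B)"
    using self_dom_number_le_card[OF dom(1,3), of "ennreal c"] w(2) c
    by (simp add: \<gamma>_def c_def ennreal_of_nat_eq_real_of_nat flip: dom(2))
  moreover have "0 \<le> B"
    using dom(2) by linarith
  ultimately have upper: "w \<le> of_int B"
    by simp
  have "w \<noteq> of_int B - of_int i / of_int t" if i: "t - s + 1 \<le> i" "i \<le> t - 1" for i
  proof
    assume weq: "w = of_int B - of_int i / of_int t"
    have "real_of_int Z = of_int (t * B - i)"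
      using t weq by (simp add: Z field_simps)
    then have Zeq: "Z = t * B - i"
      by (simp only: of_int_eq_iff)
    \<comment> \<open>With \<open>m = 0\<close> the weight would be an integer and \<open>t\<close>
      would divide \<open>i\<close>, although \<open>0 < i < t\<close>.\<close>
    have "m \<noteq> 0"
    proof
      assume "m = 0"
      then have "i = t * (B - int k)"
        using Zeq by (simp add: Z_def algebra_simps)
      then have "t dvd i"
        by simp
      then show False
        using i st zdvd_not_zless[of i t] by auto
    qed
    \<comment> \<open>Now \<open>k * t \<le> B * t - i - s\<close>, and
      \<open>i \<ge> t - s + 1\<close> puts this strictly below \<open>(B - 1) * t\<close>.\<close>
    then have "s \<le> s * int m"
      using st by simp
    moreover have "int k * t + s * int m = B * t - i" "(B - 1) * t = B * t - t"
      using Zeq by (simp_all add: Z_def algebra_simps)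
    ultimately have "int k * t < (B - 1) * t"
      using i by linarith
    then have "k \<le> B - 2"
      using t by simp
    moreover have "of_int (B - 1) \<le> floor_frac t a + 1 / of_int t"
      by (simp add: B_def)
    moreover have "floor_frac t a \<le> a"
      using t by (simp add: fl divide_le_eq mult.commute)
    ultimately have B: "real k \<le> of_int B - 2" "of_int B \<le> a + 1 / of_int t + 1"
      by linarith+
    have "1 / real_of_int t \<le> 1 / 2"
      using st by (intro divide_left_mono) auto
    then have ka: "real k \<le> a - 1 / 2"
      using B by linarith
    \<comment> \<open>Here the constant \<open>3\<close> arises: \<open>i \<ge> 1\<close> gives
      \<open>c * m = B - i / t - k \<le> (a - k) + 1\<close>, and
      \<open>1 \<le> 2 * (a - k)\<close>.\<close>
    have "1 / real_of_int t \<le> of_int i / of_int t"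
      using st i by (intro divide_right_mono) auto
    then have "c * real m \<le> 3 * (a - real k)"
      using B weq ka by (simp add: w_def)
    then show False
      using few' ka by simp
  qed
  then have "w \<in> {floor_frac t a + 1 / of_int t .. of_int B} -
      {of_int B - of_int i / of_int t | i :: int. t - s + 1 \<le> i \<and> i \<le> t - 1}"
    using lower upper by auto
  then show ?thesis
    using w by (auto simp: enn2ereal_ennreal)
qed

theorem theorem1p3:
  fixes s t :: int and p :: real
  assumes "2 \<le> s" and "s \<le> t - 1" and "0 < p" and "p < 1"
  shows "(\<lambda>n. measure_pmf.prob (gnp n p)
            {E. enn2ereal (self_dom_number (ennreal (of_int s / of_int t)) {1..n} E) \<in>
                ereal ` ({floor_frac t (a_fun p n) + 1 / of_int t .. of_int (b_fun p t n)} -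
                         {of_int (b_fun p t n) - of_int i / of_int t | i :: int.
                            t - s + 1 \<le> i \<and> i \<le> t - 1})})
          \<longlonglongrightarrow> 1"
proof -
  define K where "K = 3 * real_of_int t / of_int s"
  define r where "r n = nat (b_fun p t n)" for n
  define good where "good n = {E. enn2ereal (self_dom_number (ennreal (of_int s / of_int t)) {1..n} E) \<in>
    ereal ` ({floor_frac t (a_fun p n) + 1 / of_int t .. of_int (b_fun p t n)} -
      {of_int (b_fun p t n) - of_int i / of_int t | i :: int. t - s + 1 \<le> i \<and> i \<le> t - 1})}" for n
  define few where "few n = {E. \<exists>D\<subseteq>{1..n}. real (card D) \<le> a_fun p n \<and>
    real (card (undominated n E D)) \<le> K * (a_fun p n - real (card D))}" for n
  define nodom where "nodom n = {E. \<forall>D\<subseteq>{1..n}. card D = r n \<longrightarrow> undominated n E D \<noteq> {}}" for n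
  have t: "t \<ge> 3"
    using assms by simp
  \<comment> \<open>The first bound supplies the margin \<open>\<delta> = 1 / t\<close> for the
    second moment. It comes from integrality: \<open>z + 1 < t * b\<close> sharpens to
    \<open>z + 2 \<le> t * b\<close>, while \<open>t * a < z + 1\<close>.\<close>
  have b: "a_fun p n + 1 / t \<le> b_fun p t n" "b_fun p t n \<le> a_fun p n + 2" for n
  proof -
    define z where "z = \<lfloor>of_int t * a_fun p n\<rfloor>"
    have fl: "floor_frac t (a_fun p n) = of_int z / of_int t"
      using t by (simp add: floor_frac_eq z_def)
    have "b_fun p t n = \<lfloor>real_of_int (z + 1) / of_int t\<rfloor> + 1"
      by (simp add: b_fun_def fl add_divide_distrib)
    then have beq: "b_fun p t n = (z + 1) div t + 1"
      by (simp only: floor_divide_of_int_eq)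
    have "z + 1 < t * b_fun p t n"
      using t by (simp add: beq algebra_simps) (smt (verit) mult_div_mod_eq pos_mod_bound)
    then have "real_of_int (z + 2) \<le> of_int (t * b_fun p t n)"
      unfolding of_int_le_iff by simp
    moreover have "of_int t * a_fun p n < z + 1"
      unfolding z_def by linarith
    ultimately have "of_int t * a_fun p n + 1 \<le> of_int t * b_fun p t n"
      by simp
    then show "a_fun p n + 1 / t \<le> b_fun p t n"
      using t by (simp add: field_simps)
    have "real_of_int z / of_int t \<le> a_fun p n"
      using t by (simp add: z_def divide_le_eq mult.commute)
    moreover have "1 / real_of_int t \<le> 1"
      using t by simp
    moreover have "of_int (b_fun p t n) \<le> real_of_int z / of_int t + 1 / t + 1"
      by (simp add: b_fun_def fl)
    ultimately show "b_fun p t n \<le> a_fun p n + 2"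
      by linarith
  qed
  define \<beta> where "\<beta> = - ln (1 - p)"
  have \<beta>: "\<beta> > 0"
    using assms by (simp add: \<beta>_def)
  have "eventually (\<lambda>n. a_asymp \<beta> n \<ge> 0) sequentially"
    unfolding a_asymp_def using \<beta> by real_asymp
  then have "eventually (\<lambda>n. a_fun p n \<ge> 0) sequentially"
    using eventually_ge_at_top[of 2]
    by eventually_elim (use assms in \<open>simp add: a_fun_eq \<beta>_def\<close>)
  \<comment> \<open>\<open>nat\<close> truncates negative values, so \<open>r n\<close> is the
    intended size once \<open>b_fun p t n\<close> is known to be positive.\<close>
  then have r: "eventually (\<lambda>n. int (r n) = b_fun p t n) sequentially"
  proof eventually_elim
    case (elim n)
    moreover have "0 < 1 / real_of_int t"
      using t by simp
    ultimately have "0 < real_of_int (b_fun p t n)"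
      using b(1)[of n] by linarith
    then show ?case
      by (simp add: r_def)
  qed
  then have "eventually (\<lambda>n. a_fun p n + 1 / t \<le> r n \<and> r n \<le> a_fun p n + 2) sequentially"
  proof eventually_elim
    case (elim n)
    then have "real (r n) = of_int (b_fun p t n)"
      by (metis of_int_of_nat_eq)
    then show ?case
      using b[of n] by simp
  qed
  then have nodom0: "(\<lambda>n. measure_pmf.prob (gnp n p) (nodom n)) \<longlonglongrightarrow> 0"
    unfolding nodom_def using assms t by (intro prob_gnp_no_dominating_tendsto_0[where \<delta> = "1 / t"]) auto
  have few0: "(\<lambda>n. measure_pmf.prob (gnp n p) (few n)) \<longlonglongrightarrow> 0"
    unfolding few_def using assms by (intro prob_gnp_few_undominated_tendsto_0) (auto simp: K_def)
  \<comment> \<open>Outside the exceptional events \<open>few n\<close> and \<open>nodom n\<close>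
    the deterministic lemma applies; a union bound does the rest.\<close>
  have ev: "eventually (\<lambda>n. 1 - (measure_pmf.prob (gnp n p) (few n) + measure_pmf.prob (gnp n p) (nodom n))
      \<le> measure_pmf.prob (gnp n p) (good n)) sequentially"
    using r
  proof eventually_elim
    case (elim n)
    have "E \<in> good n" if E: "E \<notin> few n" "E \<notin> nodom n" for E
    proof -
      obtain D0 where "D0 \<subseteq> {1..n}" "card D0 = r n" "undominated n E D0 = {}"
        using E(2) by (auto simp: nodom_def)
      moreover have "real (card (undominated n E D)) > 3 * of_int t / of_int s * (a_fun p n - real (card D))"
        if "D \<subseteq> {1..n}" "real (card D) \<le> a_fun p n" for D
        using E(1) that unfolding few_def K_def mem_Collect_eq not_le[symmetric] by blast
      ultimately show ?thesis
        unfolding good_def b_fun_def mem_Collect_eq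
        using elim assms by (intro self_dom_number_in_range) (auto simp: b_fun_def)
    qed
    then have "UNIV - good n \<subseteq> few n \<union> nodom n"
      by auto
    then have "measure_pmf.prob (gnp n p) (UNIV - good n) \<le> measure_pmf.prob (gnp n p) (few n \<union> nodom n)"
      by (intro measure_pmf.finite_measure_mono) auto
    also have "\<dots> \<le> measure_pmf.prob (gnp n p) (few n) + measure_pmf.prob (gnp n p) (nodom n)"
      by (intro measure_Un_le) auto
    finally show ?case
      using measure_pmf.prob_compl[of "good n" "gnp n p"] by simp
  qed
  have lower: "(\<lambda>n. 1 - (measure_pmf.prob (gnp n p) (few n) + measure_pmf.prob (gnp n p) (nodom n)))
      \<longlonglongrightarrow> 1"
    using tendsto_diff[OF tendsto_const[of 1] tendsto_add[OF few0 nodom0]] by simp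
  have "(\<lambda>n. measure_pmf.prob (gnp n p) (good n)) \<longlonglongrightarrow> 1"
    by (rule tendsto_sandwich[OF ev _ lower tendsto_const]) simp
  then show ?thesis
    unfolding good_def .
qed

end
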